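(* Let $M$ be a smooth manifold of dimension $n\ge3$ with a metric $g$ of any signature. Let $R$ be the Riemann curvature tensor and $C$ the Weyl curvature of $g$, both regarded as $\mathrm{End}(TM)$-valued 2-forms, and let $\tau_k$ be the $k$-th conformal Pontrjagin (character) form of the conformal class $[g]$. Then for every $k\ge1$, as differential forms, $$\tau_k=\frac{1}{(2k)!}\,s_{2k}\!\left(\frac{-1}{2\pi\sqrt{-1}}\,C\right)=\frac{1}{(2k)!}\,s_{2k}\!\left(\frac{-1}{2\pi\sqrt{-1}}\,R\right).$$
   Context: For a vector bundle $\mathcal V$ and an $\mathrm{End}(\mathcal V)$-valued 2-form $F$, $s_{j}(F)=\mathrm{Tr}(FF\cdots F)$ ($j$ factors), where the product composes endomorphisms and wedges the form parts; this is a $2j$-form. Tractor connection. Let $\mathcal E[w]$ be the bundle of conformal densities of weight $w$ (normalised so that $(-n)$-densities are integrable), and $\boldsymbol g\in S^2T^*M\otimes\mathcal E[2]$ the conformal metric, used to raise and lower indices. For a metric $g$ in the conformal class let $\nabla$ be its Levi-Civita connection (also on densities) and $\mathsf P=\frac{1}{n-2}(\mathrm{Ric}-\mathsf J g)$ its Schouten tensor, $\mathsf J=\mathrm{tr}_g\mathsf P=\mathrm{Scal}/(2(n-1))$. The standard tractor bundle $\mathbb T$ is the real rank $n+2$ bundle which for each $g$ in the conformal class is identified with $\mathcal E[1]\oplus (T^*M\otimes\mathcal E[1])\oplus\mathcal E[-1]$, where under $\hat g=e^{2\omega}g$, with $\Upsilon=d\omega$, the triples are identified by $(\sigma,\mu_a,\rho)\mapsto(\sigma,\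 \mu_a+\Upsilon_a\sigma,\ \rho-\Upsilon^b\mu_b-\tfrac12\Upsilon^b\Upsilon_b\sigma)$. The (conformally invariant) tractor connection is $$\nabla_a(\sigma,\mu_b,\rho)=(\nabla_a\sigma-\mu_a,\ \nabla_a\mu_b+\boldsymbol g_{ab}\rho+\mathsf P_{ab}\sigma,\ \nabla_a\rho-\mathsf P_{ab}\mu^b).$$ Let $\Omega$ be its curvature. The $k$-th conformal Pontrjagin (character) form is $\tau_k=\frac{1}{(2k)!}s_{2k}\!\left(\frac{-1}{2\pi\sqrt{-1}}\Omega\right)$, a closed $4k$-form depending only on the conformal class. *)

theory Defs
  imports "HOL-Analysis.Analysis"
begin

section \<open>Smooth manifolds\<close>

definition partial_deriv ::
    "'n \<Rightarrow> (real^'n::finite \<Rightarrow> 'b::real_normed_vector) \<Rightarrow> real^'n \<Rightarrow> 'b" where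
  "partial_deriv i f x = frechet_derivative f (at x) (axis i 1)"

fun iter_partial_deriv ::
    "'n list \<Rightarrow> (real^'n::finite \<Rightarrow> 'b::real_normed_vector) \<Rightarrow> real^'n \<Rightarrow> 'b" where
  "iter_partial_deriv [] f = f"
| "iter_partial_deriv (i # is) f = partial_deriv i (iter_partial_deriv is f)"

text \<open>Only used for open \<open>S\<close>, where it says that \<open>f\<close> is of class $C^\infty$.\<close>

definition smooth_on :: "(real^'n::finite) set \<Rightarrow> (real^'n \<Rightarrow> 'b::real_normed_vector) \<Rightarrow> bool" where
  "smooth_on S f \<longleftrightarrow> (\<forall>is. \<forall>x\<in>S. iter_partial_deriv is f differentiable (at x))"

text \<open>A chart is a pair of a domain and a coordinate map.\<close>

type_synonym ('m, 'n) chart = "'m set \<times> ('m \<Rightarrow> real^'n)"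

definition chart_image :: "('m, 'n::finite) chart \<Rightarrow> (real^'n) set" where
  "chart_image c = snd c ` fst c"

definition chart_inv :: "('m, 'n::finite) chart \<Rightarrow> real^'n \<Rightarrow> 'm" where
  "chart_inv c = inv_into (fst c) (snd c)"

definition transition_dom :: "('m, 'n::finite) chart \<Rightarrow> ('m, 'n) chart \<Rightarrow> (real^'n) set" where
  "transition_dom c d = snd c ` (fst c \<inter> fst d)"

definition transition :: "('m, 'n::finite) chart \<Rightarrow> ('m, 'n) chart \<Rightarrow> real^'n \<Rightarrow> real^'n" where
  "transition c d = snd d \<circ> chart_inv c"

text \<open>A smooth manifold of dimension \<open>CARD('n)\<close>, given by its underlying topological space and a
  (not necessarily maximal) smooth atlas.\<close>

definition smooth_manifold :: "'m topology \<Rightarrow> ('m, 'n::finite) chart set \<Rightarrow> bool" where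
  "smooth_manifold M A \<longleftrightarrow>
     Hausdorff_space M \<and> second_countable M \<and>
     (\<Union>c\<in>A. fst c) = topspace M \<and>
     (\<forall>c\<in>A. openin M (fst c) \<and> open (chart_image c) \<and>
        homeomorphic_map (subtopology M (fst c)) (top_of_set (chart_image c)) (snd c)) \<and>
     (\<forall>c\<in>A. \<forall>d\<in>A. smooth_on (transition_dom c d) (transition c d))"

definition smooth_function :: "('m, 'n::finite) chart set \<Rightarrow> ('m \<Rightarrow> real) \<Rightarrow> bool" where
  "smooth_function A f \<longleftrightarrow> (\<forall>c\<in>A. smooth_on (chart_image c) (f \<circ> chart_inv c))"

section \<open>Metrics and conformal classes\<close>

text \<open>A metric is given by its component matrices $g_{ab}$ in each chart of the atlas, related by
  the transformation law of covariant 2-tensors.  Nondegeneracy without any condition on signs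
  allows every signature.\<close>

type_synonym ('m, 'n) metric = "('m, 'n) chart \<Rightarrow> real^'n \<Rightarrow> real^'n^'n"

definition pseudo_riemannian_metric ::
    "('m, 'n::finite) chart set \<Rightarrow> ('m, 'n) metric \<Rightarrow> bool" where
  "pseudo_riemannian_metric A g \<longleftrightarrow>
     (\<forall>c\<in>A. (\<forall>a b. smooth_on (chart_image c) (\<lambda>x. g c x $ a $ b)) \<and>
            (\<forall>x\<in>chart_image c. transpose (g c x) = g c x \<and> invertible (g c x))) \<and>
     (\<forall>c\<in>A. \<forall>d\<in>A. \<forall>x\<in>transition_dom c d.
        let J = matrix (frechet_derivative (transition c d) (at x))
        in g c x = transpose J ** g d (transition c d x) ** J)"

definition conformal_class ::
    "('m, 'n::finite) chart set \<Rightarrow> ('m, 'n) metric \<Rightarrow> ('m, 'n) metric set" where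
  "conformal_class A g =
     {h. \<exists>\<omega>. smooth_function A \<omega> \<and>
          (\<forall>c\<in>A. \<forall>x\<in>chart_image c. h c x = exp (2 * \<omega> (chart_inv c x)) *\<^sub>R g c x)}"

section \<open>Connections and curvature in a chart\<close>

text \<open>From here on everything happens on a coordinate patch: \<open>g\<close> is the matrix of components of
  the metric as a function of the coordinates.  A connection on a bundle trivialised over the
  patch is given by its covariant derivatives \<open>D a\<close> along the coordinate fields.  As these fields
  commute, its curvature is $F_{ab} = D_a D_b - D_b D_a$.  This operator is tensorial, so its
  matrix can be read off from constant sections.\<close>

definition curvature ::
    "('n::finite \<Rightarrow> (real^'n \<Rightarrow> real^'m::finite) \<Rightarrow> real^'n \<Rightarrow> real^'m)
      \<Rightarrow> 'n \<Rightarrow> 'n \<Rightarrow> real^'n \<Rightarrow> real^'m^'m" where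
  "curvature D a b x = matrix (\<lambda>v. D a (D b (\<lambda>_. v)) x - D b (D a (\<lambda>_. v)) x)"

text \<open>\<open>christoffel g c a b\<close> is $\Gamma^c{}_{ab}$.\<close>

definition christoffel ::
    "(real^'n \<Rightarrow> real^'n^'n) \<Rightarrow> 'n::finite \<Rightarrow> 'n \<Rightarrow> 'n \<Rightarrow> real^'n \<Rightarrow> real" where
  "christoffel g c a b x =
     1/2 * (\<Sum>d\<in>UNIV. matrix_inv (g x) $ c $ d *
       (partial_deriv a (\<lambda>y. g y $ d $ b) x + partial_deriv b (\<lambda>y. g y $ d $ a) x
        - partial_deriv d (\<lambda>y. g y $ a $ b) x))"

definition levi_civita ::
    "(real^'n \<Rightarrow> real^'n^'n) \<Rightarrow> 'n::finite \<Rightarrow> (real^'n \<Rightarrow> real^'n) \<Rightarrow> real^'n \<Rightarrow> real^'n" where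
  "levi_civita g a V x =
     (\<chi> c. partial_deriv a (\<lambda>y. V y $ c) x + (\<Sum>b\<in>UNIV. christoffel g c a b x * V x $ b))"

text \<open>\<open>riemann g a b x $ c $ d\<close> is $R_{ab}{}^c{}_d$ and \<open>weyl g a b x $ c $ d\<close> is
  $C_{ab}{}^c{}_d$.\<close>

definition riemann ::
    "(real^'n \<Rightarrow> real^'n^'n) \<Rightarrow> 'n::finite \<Rightarrow> 'n \<Rightarrow> real^'n \<Rightarrow> real^'n^'n" where
  "riemann g = curvature (levi_civita g)"

definition ricci :: "(real^'n \<Rightarrow> real^'n^'n) \<Rightarrow> 'n::finite \<Rightarrow> 'n \<Rightarrow> real^'n \<Rightarrow> real" where
  "ricci g a b x = (\<Sum>c\<in>UNIV. riemann g c a x $ c $ b)"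

definition scalar_curvature :: "(real^'n \<Rightarrow> real^'n^'n) \<Rightarrow> real^'n::finite \<Rightarrow> real" where
  "scalar_curvature g x = (\<Sum>a\<in>UNIV. \<Sum>b\<in>UNIV. matrix_inv (g x) $ a $ b * ricci g a b x)"

definition schouten :: "(real^'n \<Rightarrow> real^'n^'n) \<Rightarrow> 'n::finite \<Rightarrow> 'n \<Rightarrow> real^'n \<Rightarrow> real" where
  "schouten g a b x =
     (ricci g a b x - scalar_curvature g x / (2 * (real CARD('n) - 1)) * g x $ a $ b)
       / (real CARD('n) - 2)"

text \<open>$R_{abcd} = C_{abcd} + g_{ac} P_{bd} - g_{bc} P_{ad} + g_{bd} P_{ac} - g_{ad} P_{bc}$,
  with the index $c$ raised.\<close>

definition weyl ::
    "(real^'n \<Rightarrow> real^'n^'n) \<Rightarrow> 'n::finite \<Rightarrow> 'n \<Rightarrow> real^'n \<Rightarrow> real^'n^'n" where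
  "weyl g a b x =
     (\<chi> c d. riemann g a b x $ c $ d
        - ((if c = a then schouten g b d x else 0) - (if c = b then schouten g a d x else 0)
           + g x $ b $ d * (\<Sum>e\<in>UNIV. matrix_inv (g x) $ c $ e * schouten g a e x)
           - g x $ a $ d * (\<Sum>e\<in>UNIV. matrix_inv (g x) $ c $ e * schouten g b e x)))"

section \<open>The tractor connection in a chart\<close>

text \<open>The coordinate density trivialises all density bundles over the patch: a section of
  $\mathcal{E}[w]$ is written as $f\,|dx|^{-w/n}$, so that $(-n)$-densities are integrable.  The
  Levi-Civita connection then acts on $f$ through the contracted Christoffel symbols:
  \<open>density_coeff g w a\<close> is $\frac{w}{n}\Gamma^c{}_{ca}$.\<close>

definition density_coeff ::
    "(real^'n \<Rightarrow> real^'n^'n) \<Rightarrow> real \<Rightarrow> 'n::finite \<Rightarrow> real^'n \<Rightarrow> real" where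
  "density_coeff g w a x = w / real CARD('n) * (\<Sum>c\<in>UNIV. christoffel g c c a x)"

text \<open>The $\mathcal{E}[2]$-valued conformal metric in the trivialisation by the coordinate density;
  it is unchanged when \<open>g\<close> is rescaled.\<close>

definition conformal_metric :: "(real^'n \<Rightarrow> real^'n^'n) \<Rightarrow> real^'n::finite \<Rightarrow> real^'n^'n" where
  "conformal_metric g x = (\<bar>det (g x)\<bar> powr (- 1 / real CARD('n))) *\<^sub>R g x"

text \<open>The metric \<open>g\<close> splits the tractor bundle as
  $\mathcal{E}[1] \oplus (T^*M\otimes\mathcal{E}[1]) \oplus \mathcal{E}[-1]$; in coordinates a
  tractor $(\sigma,\mu_b,\rho)$ is a vector indexed by \<open>unit + 'n + unit\<close>.\<close>

type_synonym 'n tractor_index = "unit + 'n + unit"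

definition tractor_connection ::
    "(real^'n \<Rightarrow> real^'n^'n) \<Rightarrow> 'n::finite
      \<Rightarrow> (real^'n \<Rightarrow> real^('n tractor_index)) \<Rightarrow> real^'n \<Rightarrow> real^('n tractor_index)" where
  "tractor_connection g a s x =
    (let \<sigma> = (\<lambda>y. s y $ Inl ());
         \<mu> = (\<lambda>b y. s y $ Inr (Inl b));
         \<rho> = (\<lambda>y. s y $ Inr (Inr ()));
         \<mu>_up = (\<lambda>b. \<Sum>c\<in>UNIV. matrix_inv (conformal_metric g x) $ b $ c * \<mu> c x)
     in \<chi> i. case i of
          Inl _ \<Rightarrow> partial_deriv a \<sigma> x + density_coeff g 1 a x * \<sigma> x - \<mu> a x
        | Inr (Inl b) \<Rightarrow>
            partial_deriv a (\<mu> b) x - (\<Sum>c\<in>UNIV. christoffel g c a b x * \<mu> c x)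
              + density_coeff g 1 a x * \<mu> b x
            + conformal_metric g x $ a $ b * \<rho> x + schouten g a b x * \<sigma> x
        | Inr (Inr _) \<Rightarrow>
            partial_deriv a \<rho> x + density_coeff g (- 1) a x * \<rho> x
            - (\<Sum>b\<in>UNIV. schouten g a b x * \<mu>_up b))"

definition tractor_curvature ::
    "(real^'n \<Rightarrow> real^'n^'n) \<Rightarrow> 'n::finite \<Rightarrow> 'n \<Rightarrow> real^'n
      \<Rightarrow> real^('n tractor_index)^('n tractor_index)" where
  "tractor_curvature g = curvature (tractor_connection g)"

section \<open>Endomorphism-valued forms and characteristic forms\<close>

text \<open>The value at a point of an $\mathrm{End}(V)$-valued \<open>p\<close>-form (over the complex numbers) is a
  function of a sequence of tangent vectors which depends only on the first \<open>p\<close> of them; the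
  degree is passed explicitly to the wedge product.\<close>

type_synonym ('n, 'm) end_form = "(nat \<Rightarrow> real^'n) \<Rightarrow> complex^'m^'m"

definition end_wedge ::
    "nat \<Rightarrow> nat \<Rightarrow> ('n::finite, 'm::finite) end_form \<Rightarrow> ('n, 'm) end_form \<Rightarrow> ('n, 'm) end_form" where
  "end_wedge p q F G v =
     (1 / (fact p * fact q)) *\<^sub>R
       (\<Sum>\<pi> | \<pi> permutes {..<p + q}.
          of_int (sign \<pi>) *\<^sub>R (F (\<lambda>i. v (\<pi> i)) ** G (\<lambda>i. v (\<pi> (p + i)))))"

fun end_power :: "('n::finite, 'm::finite) end_form \<Rightarrow> nat \<Rightarrow> ('n, 'm) end_form" where
  "end_power F 0 = (\<lambda>v. mat 1)"
| "end_power F (Suc j) = end_wedge 2 (2 * j) F (end_power F j)"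

text \<open>$s_j(F) = \mathrm{Tr}(F \cdots F)$ with \<open>j\<close> factors, for a 2-form \<open>F\<close>.\<close>

definition trace_form ::
    "nat \<Rightarrow> ('n::finite, 'm::finite) end_form \<Rightarrow> (nat \<Rightarrow> real^'n) \<Rightarrow> complex" where
  "trace_form j F v = trace (end_power F j v)"

text \<open>The 2-form $z \cdot \frac12 F_{ab}\, dx^a \wedge dx^b$ with a complex scalar \<open>z\<close>.\<close>

definition scaled_two_form ::
    "complex \<Rightarrow> ('n::finite \<Rightarrow> 'n \<Rightarrow> real^'m::finite^'m) \<Rightarrow> ('n, 'm) end_form" where
  "scaled_two_form z F v =
     (\<chi> i j. z * complex_of_real (\<Sum>a\<in>UNIV. \<Sum>b\<in>UNIV. v 0 $ a * v 1 $ b * F a b $ i $ j))"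

definition pontrjagin_character ::
    "nat \<Rightarrow> ('n::finite \<Rightarrow> 'n \<Rightarrow> real^'m::finite^'m) \<Rightarrow> (nat \<Rightarrow> real^'n) \<Rightarrow> complex" where
  "pontrjagin_character k F v =
     1 / fact (2 * k) *
       trace_form (2 * k) (scaled_two_form (- 1 / (2 * complex_of_real pi * \<i>)) F) v"

text \<open>The form $\tau_k$ at the point with coordinates \<open>x\<close>, computed from the metric \<open>g\<close> of the
  conformal class.\<close>

definition conformal_pontrjagin ::
    "nat \<Rightarrow> (real^'n \<Rightarrow> real^'n^'n) \<Rightarrow> real^'n::finite \<Rightarrow> (nat \<Rightarrow> real^'n) \<Rightarrow> complex" where
  "conformal_pontrjagin k g x = pontrjagin_character k (\<lambda>a b. tractor_curvature g a b x)"

end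

theory Submission
  imports Defs
begin

text \<open>
  All three forms are traces of powers of curvature two-forms, and the argument is algebraic once
  the curvatures are known at a point.  In the splitting by a metric, the tractor curvature is
  block lower triangular with vanishing outer diagonal blocks and middle block $-C^T$, which is
  conjugate to $C$ by the metric; hence it has the same traces as $C$.  The Weyl tensor $C$ does
  not depend on the metric in the conformal class.  Finally
  $R^c{}_d = C^c{}_d + \theta^c\wedge P_d + P^c\wedge\theta_d$, where $\theta^c = dx^c$ and $P_d = P_{bd}\,dx^b$.
  The Bianchi identities give $X\theta = 0$ and $\theta^T X = 0$ for $X = R, C$, so that in the telescoping sum
  $R^j - C^j = \sum_i R^i (R - C) C^{j-1-i}$ every term has trace zero as soon as $j \ge 2$, up to a cyclic
  rotation of the factors.
\<close>

section \<open>Alternation and powers of two-forms\<close>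

text \<open>Wedge products of matrix-valued forms do not commute, so X theta = 0 and theta^T X = 0
  act only on neighbouring factors. Products are therefore formed without antisymmetrisation, each
  factor reading its own argument slots, and one alternation over all slots is applied to the trace.
  A Bianchi identity is then a vanishing sum over a 3-cycle of slots; as 3-cycles are even, its
  three terms have equal alternations, which must vanish. The normalisation of the wedge product and
  the complex scalar collect into one factor depending only on k, so an equality of real alternated
  traces remains. The Cotton-type entries of the tractor curvature lie below the diagonal blocks and
  never have to be computed. Replacing -C^T by its conjugate g C g^-1 keeps the order of the
  factors, which a bare transposition would reverse. The tractor form may be computed from any h in
  the class, while C and R belong to g; this is why the conformal change of the Weyl tensor
  enters.\<close>

definition alternation :: "nat \<Rightarrow> ((nat \<Rightarrow> 'v) \<Rightarrow> 'b::real_vector) \<Rightarrow> (nat \<Rightarrow> 'v) \<Rightarrow> 'b" where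
  "alternation m T v = (\<Sum>\<pi> | \<pi> permutes {..<m}. of_int (sign \<pi>) *\<^sub>R T (\<lambda>i. v (\<pi> i)))"

lemma alternation_add: "alternation m (\<lambda>v. S v + T v) v = alternation m S v + alternation m T v"
  by (simp add: alternation_def scaleR_right_distrib sum.distrib)

text \<open>Reindexing the sum by right composition with \<open>q\<close> multiplies every sign by
  \<open>sign q\<close>; that sign is its own inverse and can be moved to the other side.\<close>

lemma alternation_permute:
  assumes "q permutes {..<m}"
  shows "alternation m (\<lambda>v. T (\<lambda>i. v (q i))) v = of_int (sign q) *\<^sub>R alternation m T v"
proof -
  have q: "permutation q"
    using assms permutation_permutes by blast
  have *: "sign (\<lambda>i. p (q i)) = sign p * sign q" if "p permutes {..<m}" for p
    using sign_compose[OF permutes_imp_permutation[OF _ that] q] by (simp add: o_def)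
  have "alternation m T v = (\<Sum>\<pi> | \<pi> permutes {..<m}. of_int (sign (\<pi> \<circ> q)) *\<^sub>R T (\<lambda>i. v ((\<pi> \<circ> q) i)))"
    unfolding alternation_def by (rule sum_permutations_compose_right[OF assms])
  also have "\<dots> = of_int (sign q) *\<^sub>R alternation m (\<lambda>v. T (\<lambda>i. v (q i))) v"
    unfolding alternation_def scaleR_sum_right
    by (rule sum.cong) (auto simp: * o_def mult.commute)
  finally have "of_int (sign q) *\<^sub>R alternation m T v =
      (of_int (sign q) * of_int (sign q)) *\<^sub>R alternation m (\<lambda>v. T (\<lambda>i. v (q i))) v"
    by simp
  also have "of_int (sign q) * of_int (sign q) = (1::real)"
    by (metis of_int_1 of_int_mult sign_idempotent)
  finally show ?thesis by simp
qed

text \<open>A 3-cycle is even, so \<open>T\<close> and its two cyclic shifts have the same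
  alternation; three times that alternation is the alternation of zero.\<close>

lemma alternation_cyclic_zero:
  fixes T :: "(nat \<Rightarrow> 'v) \<Rightarrow> 'b::real_vector"
  assumes "p < m" "q < m" "r < m" "p \<noteq> q" "q \<noteq> r" "p \<noteq> r"
    and c: "c = Transposition.transpose p q \<circ> Transposition.transpose q r"
    and T: "\<And>v. T v + T (\<lambda>i. v (c i)) + T (\<lambda>i. v (c (c i))) = 0"
  shows "alternation m T v = 0"
proof -
  have c1: "c permutes {..<m}"
    unfolding c using assms by (intro permutes_compose permutes_swap_id) auto
  have c2: "(\<lambda>i. c (c i)) permutes {..<m}"
    using permutes_compose[OF c1 c1] by (simp add: o_def)
  have s: "sign c = 1"
    unfolding c using assms by (simp add: sign_compose sign_swap_id permutation_swap_id)
  have s2: "sign (\<lambda>i. c (c i)) = 1"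
    using sign_compose[of c c] s permutes_imp_permutation[OF _ c1] by (simp add: o_def)
  have "0 = alternation m (\<lambda>v. T v + T (\<lambda>i. v (c i)) + T (\<lambda>i. v (c (c i)))) v"
    unfolding T by (simp add: alternation_def)
  also have "\<dots> = alternation m T v + alternation m T v + alternation m T v"
    unfolding alternation_add alternation_permute[OF c1] alternation_permute[OF c2] s s2 by simp
  also have "\<dots> = 3 *\<^sub>R alternation m T v"
    by (simp add: scaleR_left_distrib[of 2 1, simplified] scaleR_2)
  finally show ?thesis by simp
qed

text \<open>The inner permutations of the last \<open>m\<close> slots extend by the identity to all
  \<open>p + m\<close> slots. The outer alternation absorbs each extension, whose sign then occurs
  twice, so all \<open>fact m\<close> summands are equal. The hypothesis on \<open>T\<close> says
  that its first argument sees only the slots fixed by the extensions.\<close>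

lemma alternation_absorb:
  "alternation (p + m) (\<lambda>v. alternation m (\<lambda>w. T v w) (\<lambda>i. v (p + i))) v =
     fact m *\<^sub>R alternation (p + m) (\<lambda>v. T v (\<lambda>i. v (p + i))) v"
  if T: "\<And>u v w. (\<And>i. i < p \<Longrightarrow> u i = v i) \<Longrightarrow> T u w = T v w"
  for T :: "(nat \<Rightarrow> 'v) \<Rightarrow> (nat \<Rightarrow> 'v) \<Rightarrow> 'b::real_vector"
proof -
  let ?ext = "\<lambda>\<sigma>. map_permutation {..<m} (\<lambda>i. p + i) \<sigma>"
  let ?U = "\<lambda>v. T v (\<lambda>i. v (p + i))"
  have ext: "?ext \<sigma> permutes {..<p + m}" "sign (?ext \<sigma>) = sign \<sigma>"
      "\<And>i. i < p \<Longrightarrow> ?ext \<sigma> i = i" "\<And>i. ?ext \<sigma> (p + i) = p + \<sigma> i"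
    if \<sigma>: "\<sigma> permutes {..<m}" for \<sigma>
  proof -
    have "bij_betw (\<lambda>i. p + i) {..<m} {p..<p + m}"
      by (simp add: bij_betw_def lessThan_atLeast0 add.commute)
    then have *: "?ext \<sigma> permutes {p..<p + m}"
      using map_permutation_permutes[OF _ \<sigma>] by blast
    then show "?ext \<sigma> permutes {..<p + m}"
      by (rule permutes_subset) auto
    show "sign (?ext \<sigma>) = sign \<sigma>"
      using \<sigma> by (intro sign_map_permutation) auto
    show "?ext \<sigma> i = i" if "i < p" for i
      using permutes_not_in[OF *, of i] that by simp
    show "?ext \<sigma> (p + i) = p + \<sigma> i" for i
    proof (cases "i < m")
      case True
      then show ?thesis
        by (simp add: map_permutation_apply)
    next
      case False
      then show ?thesis
        using permutes_not_in[OF *, of "p + i"] permutes_not_in[OF \<sigma>, of i] by simp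
    qed
  qed
  have "alternation (p + m) (\<lambda>v. alternation m (\<lambda>w. T v w) (\<lambda>i. v (p + i))) v =
      (\<Sum>\<sigma> | \<sigma> permutes {..<m}. of_int (sign \<sigma>) *\<^sub>R
        alternation (p + m) (\<lambda>v. T v (\<lambda>i. v (p + \<sigma> i))) v)"
    unfolding alternation_def scaleR_sum_right by (subst sum.swap) (simp add: mult.commute)
  also have "\<dots> = (\<Sum>\<sigma> | \<sigma> permutes {..<m}. alternation (p + m) ?U v)"
  proof (rule sum.cong[OF refl])
    fix \<sigma> assume "\<sigma> \<in> {\<sigma>. \<sigma> permutes {..<m}}"
    then have \<sigma>: "\<sigma> permutes {..<m}" by simp
    have "T v (\<lambda>i. v (p + \<sigma> i)) = ?U (\<lambda>i. v (?ext \<sigma> i))" for v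
      using ext(3)[OF \<sigma>] by (auto simp: ext(4)[OF \<sigma>] intro!: T)
    then have "alternation (p + m) (\<lambda>v. T v (\<lambda>i. v (p + \<sigma> i))) v
        = of_int (sign \<sigma>) *\<^sub>R alternation (p + m) ?U v"
      using alternation_permute[OF ext(1)[OF \<sigma>], of ?U v] ext(2)[OF \<sigma>] by simp
    then have "of_int (sign \<sigma>) *\<^sub>R alternation (p + m) (\<lambda>v. T v (\<lambda>i. v (p + \<sigma> i))) v
        = of_int (sign \<sigma>) *\<^sub>R of_int (sign \<sigma>) *\<^sub>R alternation (p + m) ?U v"
      by simp
    also have "\<dots> = of_int (sign \<sigma> * sign \<sigma>) *\<^sub>R alternation (p + m) ?U v"
      by (simp only: scaleR_scaleR of_int_mult)
    also have "\<dots> = alternation (p + m) ?U v"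
      by (simp only: sign_idempotent of_int_1 scaleR_one)
    finally show "of_int (sign \<sigma>) *\<^sub>R alternation (p + m) (\<lambda>v. T v (\<lambda>i. v (p + \<sigma> i))) v
        = alternation (p + m) ?U v"
      by simp
  qed
  also have "\<dots> = fact m *\<^sub>R alternation (p + m) ?U v"
    by (simp add: card_permutations[of _ m] sum_constant_scaleR)
  finally show ?thesis .
qed

section \<open>Products of matrix-valued 2-forms and their alternated traces\<close>

fun chain :: "('v \<Rightarrow> 'v \<Rightarrow> real^'m::finite^'m) list \<Rightarrow> (nat \<Rightarrow> 'v) \<Rightarrow> real^'m^'m" where
  "chain [] v = mat 1"
| "chain (X # Xs) v = X (v 0) (v 1) ** chain Xs (\<lambda>i. v (2 + i))"

lemma chain_Cons: "chain (X # Xs) = (\<lambda>v. X (v 0) (v 1) ** chain Xs (\<lambda>i. v (2 + i)))"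
  by (simp add: fun_eq_iff)

lemma chain_append: "chain (Xs @ Ys) v = chain Xs v ** chain Ys (\<lambda>i. v (2 * length Xs + i))"
  by (induction Xs arbitrary: v) (simp_all add: matrix_mul_assoc[symmetric] algebra_simps)

lemma chain_cong: "(\<And>i. i < 2 * length Xs \<Longrightarrow> u i = v i) \<Longrightarrow> chain Xs u = chain Xs v"
proof (induction Xs arbitrary: u v)
  case (Cons X Xs)
  have "chain Xs (\<lambda>i. u (2 + i)) = chain Xs (\<lambda>i. v (2 + i))"
    by (rule Cons.IH) (simp add: Cons.prems)
  then show ?case using Cons.prems by simp
qed simp

text \<open>Counting from 0, the k-th factor of \<open>chain\<close> reads slots 2k and 2k + 1;
  antisymmetrising once, after the product, gives the trace of the wedge product up to a
  constant.\<close>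

definition alt_trace :: "('v \<Rightarrow> 'v \<Rightarrow> real^'m::finite^'m) list \<Rightarrow> (nat \<Rightarrow> 'v) \<Rightarrow> real" where
  "alt_trace Xs v = alternation (2 * length Xs) (\<lambda>v. trace (chain Xs v)) v"

text \<open>Curvature matrices are real; splitting off the complex factor lets the matrix algebra
  run over the reals.\<close>

definition scaled_complex :: "complex \<Rightarrow> real^'m^'n \<Rightarrow> complex^'m^'n" where
  "scaled_complex z A = (\<chi> i j. z * complex_of_real (A $ i $ j))"

lemma scaled_complex_mult:
  "scaled_complex z A ** scaled_complex w B = scaled_complex (z * w) (A ** B)"
  by (simp add: scaled_complex_def matrix_matrix_mult_def vec_eq_iff sum_distrib_left algebra_simps)

lemma scaled_complex_scaleR: "scaled_complex z (r *\<^sub>R A) = r *\<^sub>R scaled_complex z A"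
  by (simp add: scaled_complex_def vec_eq_iff scaleR_conv_of_real[where 'a = complex])

lemma scaled_complex_sum: "scaled_complex z (\<Sum>i\<in>I. A i) = (\<Sum>i\<in>I. scaled_complex z (A i))"
  by (simp add: scaled_complex_def vec_eq_iff sum_distrib_left)

lemma scaled_complex_mat: "scaled_complex 1 (mat 1) = mat 1"
  by (simp add: scaled_complex_def vec_eq_iff mat_def)

lemma trace_scaled_complex: "trace (scaled_complex z A) = z * complex_of_real (trace A)"
  by (simp add: scaled_complex_def trace_def sum_distrib_left)

definition two_form :: "('n::finite \<Rightarrow> 'n \<Rightarrow> real^'m::finite^'m) \<Rightarrow> real^'n \<Rightarrow> real^'n \<Rightarrow> real^'m^'m" where
  "two_form F u w = (\<Sum>a\<in>UNIV. \<Sum>b\<in>UNIV. (u $ a * w $ b) *\<^sub>R F a b)"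

lemma scaled_two_form_eq: "scaled_two_form z F v = scaled_complex z (two_form F (v 0) (v 1))"
  by (simp add: scaled_two_form_def scaled_complex_def two_form_def vec_eq_iff)

lemma sum_matrix_mult_left:
  fixes A :: "'a::comm_semiring_1^'m^'n"
  shows "A ** (\<Sum>i\<in>I. B i) = (\<Sum>i\<in>I. A ** B i)"
  by (auto simp: matrix_matrix_mult_def vec_eq_iff sum_distrib_left intro: sum.swap)

lemma scaleR_matrix_mult_left:
  fixes A :: "'a::real_algebra_1^'m^'n"
  shows "A ** (r *\<^sub>R B) = r *\<^sub>R (A ** B)"
  by (simp add: matrix_scalar_ac scalar_matrix_assoc)

text \<open>Wedging with one more 2-form contributes 1/(2! (2j)!), and
  \<open>alternation_absorb\<close> returns (2j)!, so each factor of the power leaves exactly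
  1/2.\<close>

lemma end_power_eq:
  "end_power (scaled_two_form z F) j v =
     (1 / 2 ^ j) *\<^sub>R scaled_complex (z ^ j) (alternation (2 * j) (chain (replicate j (two_form F))) v)"
proof (induction j arbitrary: v)
  case 0
  have "{\<pi>. \<pi> permutes {..<0::nat}} = {id}" by auto
  then show ?case
    by (simp add: alternation_def scaled_complex_mat)
next
  case (Suc j)
  let ?X = "two_form F" and ?C = "chain (replicate j (two_form F))"
  have "end_power (scaled_two_form z F) (Suc j) v =
     (1 / (fact 2 * fact (2 * j))) *\<^sub>R
       (\<Sum>\<pi> | \<pi> permutes {..<2 + 2 * j}.
          of_int (sign \<pi>) *\<^sub>R (scaled_complex z (?X (v (\<pi> 0)) (v (\<pi> 1))) **
            ((1 / 2 ^ j) *\<^sub>R scaled_complex (z ^ j) (alternation (2 * j) ?C (\<lambda>i. v (\<pi> (2 + i)))))))"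
    by (simp add: end_wedge_def Suc.IH scaled_two_form_eq)
  also have "\<dots> = (1 / (fact 2 * fact (2 * j))) *\<^sub>R (1 / 2 ^ j) *\<^sub>R scaled_complex (z ^ Suc j)
      (alternation (2 + 2 * j)
        (\<lambda>v. alternation (2 * j) (\<lambda>w. ?X (v 0) (v 1) ** ?C w) (\<lambda>i. v (2 + i))) v)"
    by (simp add: alternation_def scaleR_matrix_mult_left scaled_complex_mult sum_matrix_mult_left
        scaled_complex_sum scaled_complex_scaleR scaleR_sum_right mult_ac)
  also have "alternation (2 + 2 * j)
        (\<lambda>v. alternation (2 * j) (\<lambda>w. ?X (v 0) (v 1) ** ?C w) (\<lambda>i. v (2 + i))) v =
      fact (2 * j) *\<^sub>R alternation (2 + 2 * j) (chain (replicate (Suc j) ?X)) v"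
    by (subst alternation_absorb) (simp_all add: chain_Cons)
  finally show ?case
    by (simp add: scaled_complex_scaleR del: end_power.simps chain.simps)
qed

text \<open>The prefactor does not depend on \<open>F\<close>. Equality of two characters thus
  reduces to equality of real alternated traces, even for bundles of different rank.\<close>

lemma pontrjagin_character_eq:
  "pontrjagin_character k F v =
     (- 1 / (2 * complex_of_real pi * \<i>)) ^ (2 * k) / (fact (2 * k) * 2 ^ (2 * k)) *
       complex_of_real (alt_trace (replicate (2 * k) (two_form F)) v)"
proof -
  have "trace (alternation (2 * (2 * k)) (chain (replicate (2 * k) (two_form F))) v) =
      alt_trace (replicate (2 * k) (two_form F)) v"
    unfolding alt_trace_def alternation_def trace_def
    by (simp add: sum_distrib_left) (subst sum.swap, rule)
  moreover have "trace (r *\<^sub>R A) = r *\<^sub>R trace A" for r and A :: "complex^'b^'b"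
    by (simp add: trace_def scaleR_sum_right)
  ultimately show ?thesis
    by (simp add: pontrjagin_character_def trace_form_def end_power_eq trace_scaled_complex
        scaleR_conv_of_real[where 'a = complex] field_simps)
qed

lemma matrix_add_rdistrib: "(A + B) ** C = A ** C + B ** C" for A B :: "'a::semiring_1^'m^'n"
  by (vector matrix_matrix_mult_def sum.distrib[symmetric] field_simps)

lemma alt_trace_add:
  "alt_trace (Xs @ (\<lambda>u w. X u w + Y u w) # Ys) v = alt_trace (Xs @ X # Ys) v + alt_trace (Xs @ Y # Ys) v"
proof -
  have "trace (chain (Xs @ (\<lambda>u w. X u w + Y u w) # Ys) v) =
      trace (chain (Xs @ X # Ys) v) + trace (chain (Xs @ Y # Ys) v)" for v
    by (simp add: chain_append matrix_add_ldistrib matrix_add_rdistrib trace_add)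
  then show ?thesis
    by (simp add: alt_trace_def alternation_add)
qed

lemma alt_trace_diff:
  "alt_trace (Xs @ (\<lambda>u w. X u w - Y u w) # Ys) v = alt_trace (Xs @ X # Ys) v - alt_trace (Xs @ Y # Ys) v"
  using alt_trace_add[of Xs "\<lambda>u w. X u w - Y u w" Y Ys v] by simp

text \<open>No sign arises because the shift by two places is the square of a permutation, hence even.\<close>

lemma alt_trace_rotate: "alt_trace (X # Xs) v = alt_trace (Xs @ [X]) v"
proof -
  define l where "l = 2 * length Xs"
  \<comment> \<open>The cyclic shift of the \<open>l + 2\<close> slots by one place, extended by the
    identity as \<open>permutes\<close> demands.\<close>
  define \<rho> where "\<rho> = (\<lambda>i. if i < l + 2 then Suc i mod (l + 2) else i)"
  define q where "q = \<rho> \<circ> \<rho>"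
  have inj: "inj_on \<rho> {..<l + 2}"
    unfolding inj_on_def \<rho>_def by (auto simp: mod_Suc split: if_splits)
  have "\<rho> ` {..<l + 2} \<subseteq> {..<l + 2}"
    by (auto simp: \<rho>_def)
  then have "bij_betw \<rho> {..<l + 2} {..<l + 2}"
    using inj by (simp add: bij_betw_def card_image card_subset_eq)
  then have \<rho>: "\<rho> permutes {..<l + 2}"
    by (rule bij_imp_permutes) (simp add: \<rho>_def)
  then have q: "q permutes {..<l + 2}"
    unfolding q_def by (rule permutes_compose[OF \<rho>])
  have "permutation \<rho>"
    using permutes_imp_permutation[OF _ \<rho>] by simp
  then have "sign q = 1"
    by (simp add: q_def sign_compose)
  have q_eq: "i < l \<Longrightarrow> q i = 2 + i" "q l = 0" "q (l + 1) = 1" for i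
  proof -
    have \<rho>_Suc: "\<rho> i = Suc i" if "i \<le> l" for i
      using that by (simp add: \<rho>_def)
    have \<rho>_last: "\<rho> (Suc l) = 0"
      by (simp add: \<rho>_def)
    show "i < l \<Longrightarrow> q i = 2 + i" "q l = 0" "q (l + 1) = 1" for i
      by (simp_all add: q_def \<rho>_Suc \<rho>_last)
  qed
  have "trace (chain (X # Xs) v) = trace (chain (Xs @ [X]) (\<lambda>i. v (q i)))" for v
  proof -
    have "chain Xs (\<lambda>i. v (q i)) = chain Xs (\<lambda>i. v (2 + i))"
      by (rule chain_cong) (simp add: q_eq l_def[symmetric])
    then show ?thesis
      using q_eq(2,3) by (simp add: chain_append l_def[symmetric]) (rule trace_mul_sym)
  qed
  then have "alt_trace (X # Xs) v = alternation (l + 2) (\<lambda>v. trace (chain (Xs @ [X]) (\<lambda>i. v (q i)))) v"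
    by (simp add: alt_trace_def l_def add.commute)
  also have "\<dots> = alt_trace (Xs @ [X]) v"
    using alternation_permute[OF q, of "\<lambda>v. trace (chain (Xs @ [X]) v)" v] \<open>sign q = 1\<close>
    by (simp add: alt_trace_def l_def add.commute)
  finally show ?thesis .
qed

text \<open>\<open>W\<close> is the product of two neighbouring factors on its own four slots. A
  cyclic identity in three of them survives multiplication by the other factors: the 3-cycle, moved
  to the position of the pair, leaves their slots alone.\<close>

lemma alt_trace_cyclic_zero:
  assumes pqr: "p < 4" "q < 4" "r < 4" "p \<noteq> q" "q \<noteq> r" "p \<noteq> r"
    and c: "c = Transposition.transpose p q \<circ> Transposition.transpose q r"
    and W: "\<And>v. (W v :: real^'m::finite^'m) + W (\<lambda>i. v (c i)) + W (\<lambda>i. v (c (c i))) = 0"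
    and W_eq: "\<And>v. W v = X (v 0) (v 1) ** Y (v 2) (v (3::nat))"
  shows "alt_trace (Xs @ X # Y # Ys) v = 0"
proof -
  define s where "s = 2 * length Xs"
  define c' where "c' = Transposition.transpose (s + p) (s + q) \<circ> Transposition.transpose (s + q) (s + r)"
  let ?T = "\<lambda>v. trace (chain (Xs @ X # Y # Ys) v)"
  have T_eq: "?T v = trace (chain Xs v ** (W (\<lambda>i. v (s + i)) ** chain Ys (\<lambda>i. v (s + 4 + i))))" for v
  proof -
    have "?T v = trace (chain Xs v ** chain (X # Y # Ys) (\<lambda>i. v (s + i)))"
      by (simp only: chain_append s_def)
    then show ?thesis
      by (simp add: W_eq matrix_mul_assoc[symmetric] add.assoc numeral_eq_Suc)
  qed
  have c'1: "c' i = i" if "i < s" for i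
    using that by (simp add: c'_def Transposition.transpose_def)
  have c'2: "c' (s + i) = s + c i" for i
    by (auto simp: c'_def c Transposition.transpose_def)
  have c'3: "c' (s + 4 + i) = s + 4 + i" for i
    using pqr by (auto simp: c'_def Transposition.transpose_def)
  have 1: "chain Xs (\<lambda>i. v (c' i)) = chain Xs v" "chain Xs (\<lambda>i. v (c' (c' i))) = chain Xs v" for v
    by (auto intro!: chain_cong simp: s_def[symmetric] c'1)
  have "?T v + ?T (\<lambda>i. v (c' i)) + ?T (\<lambda>i. v (c' (c' i))) =
     trace (chain Xs v ** ((W (\<lambda>i. v (s + i)) + W (\<lambda>i. v (s + c i)) + W (\<lambda>i. v (s + c (c i)))) **
       chain Ys (\<lambda>i. v (s + 4 + i))))" for v
    unfolding T_eq 1 c'3 unfolding c'2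
    by (simp add: matrix_add_ldistrib matrix_add_rdistrib trace_add)
  also have "\<dots>v = 0" for v
    using W[of "\<lambda>i. v (s + i)"] by (simp add: trace_0[unfolded mat_0])
  finally show ?thesis
    unfolding alt_trace_def
    by (intro alternation_cyclic_zero[of "s + p" _ "s + q" "s + r" c'])
       (use pqr in \<open>auto simp: s_def c'_def\<close>)
qed

section \<open>Rank-one factors, Bianchi identities and the telescoping argument\<close>

definition outer :: "real^'m \<Rightarrow> real^'n \<Rightarrow> real^'n^'m" where
  "outer u x = (\<chi> i j. u $ i * x $ j)"

lemma outer_nth [simp]: "outer u x $ i $ j = u $ i * x $ j"
  by (simp add: outer_def)

lemma matrix_mult_outer: "A ** outer u x = outer (A *v u) x"
  by (simp add: vec_eq_iff matrix_matrix_mult_def matrix_vector_mult_def sum_distrib_right mult.assoc)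

lemma outer_mult_matrix: "outer u x ** A = outer u (x v* A)"
  by (simp add: vec_eq_iff matrix_matrix_mult_def vector_matrix_mult_def sum_distrib_left mult_ac)

lemma outer_mult_outer: "outer u x ** outer w y = (x \<bullet> w) *\<^sub>R outer u y"
  by (simp add: vec_eq_iff matrix_matrix_mult_def inner_vec_def sum_distrib_left sum_distrib_right mult_ac)

lemma outer_add_left: "outer (u + w) x = outer u x + outer w x"
  and outer_add_right: "outer u (x + y) = outer u x + outer u y"
  and outer_diff_left: "outer (u - w) x = outer u x - outer w x"
  and outer_diff_right: "outer u (x - y) = outer u x - outer u y"
  and outer_scaleR_left: "outer (r *\<^sub>R u) x = r *\<^sub>R outer u x"
  and outer_scaleR_right: "outer u (r *\<^sub>R x) = r *\<^sub>R outer u x"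
  and outer_zero_left [simp]: "outer 0 x = 0"
  and outer_zero_right [simp]: "outer u 0 = 0"
  by (simp_all add: vec_eq_iff algebra_simps)

lemma transpose_outer: "Finite_Cartesian_Product.transpose (outer u x) = outer x u"
  by (simp add: vec_eq_iff Finite_Cartesian_Product.transpose_def)

text \<open>This is X theta = 0 after evaluation: theta is the identity, read as a vector-valued
  1-form.\<close>

definition bianchi :: "(real^'n \<Rightarrow> real^'n \<Rightarrow> real^'n::finite^'n) \<Rightarrow> bool" where
  "bianchi X \<longleftrightarrow> (\<forall>u v w. X u v *v w + X v w *v u + X w u *v v = 0)"

text \<open>The Bianchi identity of the adjoint, after lowering the contracted index with \<open>G\<close>.\<close>

definition cobianchi :: "(real^'n \<Rightarrow> real^'n) \<Rightarrow> (real^'n \<Rightarrow> real^'n \<Rightarrow> real^'n::finite^'n) \<Rightarrow> bool" where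
  "cobianchi G X \<longleftrightarrow> (\<forall>u v w. G w v* X u v + G u v* X v w + G v v* X w u = 0)"

text \<open>Multiplying the rank-one factor from the left by \<open>X\<close> applies
  \<open>X\<close> to its column, which is the argument in slot 2 or slot 3. The cycle runs over
  slots 0, 1 and that one, and the covector given by \<open>P\<close> is carried along
  unchanged.\<close>

lemma alt_trace_bianchi:
  assumes "bianchi X"
  shows "alt_trace (Xs @ X # (\<lambda>u w. outer u (P w)) # Ys) v = 0" (is ?th1)
    and "alt_trace (Xs @ X # (\<lambda>u w. outer w (P u)) # Ys) v = 0" (is ?th2)
proof -
  have X: "outer (X u v *v w) y + outer (X v w *v u) y + outer (X w u *v v) y = 0" for u v w y
    using assms by (simp add: bianchi_def flip: outer_add_left)
  show ?th1
    by (rule alt_trace_cyclic_zero[of 0 1 2, OF _ _ _ _ _ _ refl _ refl])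
       (simp_all add: Transposition.transpose_def matrix_mult_outer X)
  show ?th2
    by (rule alt_trace_cyclic_zero[of 0 1 3, OF _ _ _ _ _ _ refl _ refl])
       (simp_all add: Transposition.transpose_def matrix_mult_outer X)
qed

text \<open>The mirror image: multiplication by \<open>X\<close> from the right acts on the row
  \<open>G w\<close>. The cycle runs over slots 2, 3 and the slot, 1 or 0, that feeds
  \<open>G\<close>.\<close>

lemma alt_trace_cobianchi:
  assumes "cobianchi G X"
  shows "alt_trace (Xs @ (\<lambda>u w. outer (Q u) (G w)) # X # Ys) v = 0" (is ?th1)
    and "alt_trace (Xs @ (\<lambda>u w. outer (Q w) (G u)) # X # Ys) v = 0" (is ?th2)
proof -
  have X: "outer y (G w v* X u v) + outer y (G u v* X v w) + outer y (G v v* X w u) = 0" for u v w y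
    using assms by (simp add: cobianchi_def flip: outer_add_right)
  show ?th1
    by (rule alt_trace_cyclic_zero[of 1 2 3, OF _ _ _ _ _ _ refl _ refl])
       (simp_all add: Transposition.transpose_def outer_mult_matrix X)
  show ?th2
    by (rule alt_trace_cyclic_zero[of 0 2 3, OF _ _ _ _ _ _ refl _ refl])
       (simp_all add: Transposition.transpose_def outer_mult_matrix X)
qed

text \<open>The rightmost \<open>R\<close> is exchanged for \<open>C\<close>, one at a time. The
  terms with \<open>P\<close> vanish against a neighbour on their left, those with \<open>Q\<close>
  against one on their right. At either end of the word, cyclicity of the trace supplies the
  neighbour from the other end; it exists because \<open>j \<ge> 2\<close>.\<close>

lemma alt_trace_replicate_eq:
  fixes R C :: "real^'n \<Rightarrow> real^'n \<Rightarrow> real^'n::finite^'n"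
  assumes R: "R = (\<lambda>u w. C u w + (outer u (P w) - outer w (P u) + (outer (Q u) (G w) - outer (Q w) (G u))))"
    and b: "bianchi R" "bianchi C" and cb: "cobianchi G R" "cobianchi G C"
    and j: "j \<ge> 2"
  shows "alt_trace (replicate j R) v = alt_trace (replicate j C) v"
proof -
  have move: "alt_trace (replicate (Suc i) R @ replicate m C) v = alt_trace (replicate i R @ replicate (Suc m) C) v"
    if im: "i + m \<ge> 1" for i m
  proof -
    let ?Ri = "replicate i R" and ?Cm = "replicate m C"
    have A: "alt_trace (?Ri @ (\<lambda>u w. outer u (P w)) # ?Cm) v = 0 \<and>
        alt_trace (?Ri @ (\<lambda>u w. outer w (P u)) # ?Cm) v = 0"
    proof (cases i)
      case (Suc i')
      then have "?Ri = replicate i' R @ [R]"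
        by (simp add: replicate_append_same)
      then show ?thesis
        using alt_trace_bianchi[OF b(1), of "replicate i' R" P ?Cm v] by simp
    next
      case 0
      then obtain m' where "m = Suc m'"
        using im by (cases m) auto
      then have "?Cm = replicate m' C @ [C]"
        by (simp add: replicate_append_same)
      then show ?thesis
        using alt_trace_bianchi[OF b(2), of "replicate m' C" P "[]" v] 0
        by (simp add: alt_trace_rotate)
    qed
    have B: "alt_trace (?Ri @ (\<lambda>u w. outer (Q u) (G w)) # ?Cm) v = 0 \<and>
        alt_trace (?Ri @ (\<lambda>u w. outer (Q w) (G u)) # ?Cm) v = 0"
    proof (cases m)
      case (Suc m')
      then show ?thesis
        using alt_trace_cobianchi[OF cb(2), of ?Ri Q "replicate m' C" v] by simp
    next
      case 0
      then obtain i' where "i = Suc i'"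
        using im by (cases i) auto
      then show ?thesis
        using alt_trace_cobianchi[OF cb(1), of "[]" Q "replicate i' R" v] 0
          alt_trace_rotate[of _ ?Ri v]
        by (metis append_Nil replicate_Suc append_Nil2 replicate_0)
    qed
    have "replicate (Suc i) R @ ?Cm = ?Ri @ R # ?Cm"
      by (simp add: replicate_app_Cons_same)
    also have "alt_trace (?Ri @ R # ?Cm) v = alt_trace (?Ri @ C # ?Cm) v"
    proof -
      have "alt_trace (?Ri @ (\<lambda>u w. C u w + (outer u (P w) - outer w (P u) +
          (outer (Q u) (G w) - outer (Q w) (G u)))) # ?Cm) v = alt_trace (?Ri @ C # ?Cm) v"
        using A B by (simp add: alt_trace_add alt_trace_diff)
      then show ?thesis
        by (simp only: R[symmetric])
    qed
    finally show ?thesis by simp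
  qed
  have "alt_trace (replicate j R) v = alt_trace (replicate (j - i) R @ replicate i C) v" if "i \<le> j" for i
    using that
  proof (induction i)
    case (Suc i)
    then show ?case
      using move[of "j - Suc i" i] j by (simp add: Suc_diff_Suc del: replicate_Suc)
  qed simp
  from this[of j] show ?thesis by simp
qed

lemma chain_conjugate:
  fixes G Gi :: "real^'b^'b"
  assumes "G ** Gi = mat 1" "Gi ** G = mat 1"
  shows "chain (replicate j (\<lambda>u w. G ** X u w ** Gi)) v = G ** chain (replicate j X) v ** Gi"
proof (induction j arbitrary: v)
  case (Suc j)
  have "Gi ** (G ** A) = A" for A :: "real^'b^'b"
    by (simp add: matrix_mul_assoc assms)
  moreover have "chain (replicate (Suc j) (\<lambda>u w. G ** X u w ** Gi)) v =
      (G ** X (v 0) (v 1) ** Gi) ** (G ** chain (replicate j X) (\<lambda>i. v (2 + i)) ** Gi)"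
    by (simp add: Suc.IH)
  ultimately show ?case
    by (simp add: matrix_mul_assoc[symmetric])
qed (simp add: assms)

lemma alt_trace_conjugate:
  fixes G Gi :: "real^'b^'b"
  assumes "G ** Gi = mat 1" "Gi ** G = mat 1"
  shows "alt_trace (replicate j (\<lambda>u w. G ** X u w ** Gi)) v = alt_trace (replicate j X) v"
proof -
  have "trace (G ** A ** Gi) = trace A" for A :: "real^'b^'b"
    by (metis assms(2) matrix_mul_assoc matrix_mul_lid trace_mul_sym)
  then show ?thesis
    by (simp add: alt_trace_def chain_conjugate[OF assms])
qed

section \<open>Block structure of endomorphisms of the tractor bundle\<close>

lemma sum_tractor_index:
  "(\<Sum>k\<in>UNIV. f (k :: 'n::finite tractor_index)) = f (Inl ()) + (\<Sum>b\<in>UNIV. f (Inr (Inl b))) + f (Inr (Inr ()))"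
  by (simp add: UNIV_Plus_UNIV[symmetric] sum.Plus UNIV_unit add.assoc del: UNIV_Plus_UNIV)

definition middle_block ::
    "real^('n::finite tractor_index)^('n tractor_index) \<Rightarrow> real^'n^'n" where
  "middle_block A = (\<chi> b c. A $ Inr (Inl b) $ Inr (Inl c))"

text \<open>In the splitting (sigma, mu, rho), the entries left free outside the middle block
  include the Cotton-type terms of the tractor curvature.\<close>

definition strict_outer_blocks :: "real^('n::finite tractor_index)^('n tractor_index) \<Rightarrow> bool" where
  "strict_outer_blocks A \<longleftrightarrow> (\<forall>k. A $ Inl () $ k = 0 \<and> A $ k $ Inr (Inr ()) = 0)"

text \<open>Weakened by the two outer diagonal entries, so that the identity matrix, which is the
  empty chain, qualifies and can start an induction.\<close>

definition lower_blocks :: "real^('n::finite tractor_index)^('n tractor_index) \<Rightarrow> bool" where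
  "lower_blocks A \<longleftrightarrow> (\<forall>k. (k \<noteq> Inl () \<longrightarrow> A $ Inl () $ k = 0) \<and> (k \<noteq> Inr (Inr ()) \<longrightarrow> A $ k $ Inr (Inr ()) = 0))"

text \<open>A contribution to the middle block through the sigma index would use the sigma row of
  \<open>B\<close>, and one through the rho index the rho column of \<open>A\<close>; both vanish
  there.\<close>

lemma strict_outer_blocks_mult:
  assumes "strict_outer_blocks A" "lower_blocks B"
  shows "strict_outer_blocks (A ** B)" "middle_block (A ** B) = middle_block A ** middle_block B"
  using assms
  by (simp_all add: strict_outer_blocks_def lower_blocks_def middle_block_def matrix_matrix_mult_def
      sum_tractor_index vec_eq_iff)

lemma chain_strict_outer_blocks:
  assumes "\<And>u w. strict_outer_blocks (X u w)"
  shows "lower_blocks (chain (replicate j X) v) \<and>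
    middle_block (chain (replicate j X) v) = chain (replicate j (\<lambda>u w. middle_block (X u w))) v \<and>
    (j > 0 \<longrightarrow> strict_outer_blocks (chain (replicate j X) v))"
proof (induction j arbitrary: v)
  case 0
  show ?case
    by (simp add: lower_blocks_def middle_block_def mat_def vec_eq_iff)
next
  case (Suc j)
  let ?A = "chain (replicate (Suc j) X) v"
  have "strict_outer_blocks ?A" "middle_block ?A = chain (replicate (Suc j) (\<lambda>u w. middle_block (X u w))) v"
    using Suc.IH strict_outer_blocks_mult[OF assms] by simp_all
  then show ?case
    by (simp add: strict_outer_blocks_def lower_blocks_def)
qed

text \<open>\<open>j > 0\<close> excludes the empty chain, whose trace is the rank and so differs
  between the tractor bundle and its middle block.\<close>

lemma alt_trace_middle_block:
  fixes X :: "'v \<Rightarrow> 'v \<Rightarrow> real^('n::finite tractor_index)^('n tractor_index)"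
  assumes "\<And>u w. strict_outer_blocks (X u w)" "j > 0"
  shows "alt_trace (replicate j X) v = alt_trace (replicate j (\<lambda>u w. middle_block (X u w))) v"
proof -
  have "trace A = trace (middle_block A)" if "strict_outer_blocks A" for A :: "real^('n tractor_index)^('n tractor_index)"
    using that by (simp add: trace_def sum_tractor_index strict_outer_blocks_def middle_block_def)
  then show ?thesis
    using chain_strict_outer_blocks[of X j] assms by (simp add: alt_trace_def)
qed

section \<open>Partial derivatives\<close>

lemma partial_deriv_eqI: "(f has_derivative f') (at x) \<Longrightarrow> partial_deriv i f x = f' (axis i 1)"
  by (simp add: partial_deriv_def frechet_derivative_at[symmetric])

lemma differentiable_frechet: "f differentiable at x \<Longrightarrow> (f has_derivative frechet_derivative f (at x)) (at x)"
  by (simp add: frechet_derivative_works)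

lemma partial_deriv_const [simp]: "partial_deriv i (\<lambda>_. c) x = 0"
  by (rule partial_deriv_eqI) simp

lemma partial_deriv_bounded_linear:
  assumes "bounded_linear L" "f differentiable at x"
  shows "partial_deriv i (\<lambda>y. L (f y)) x = L (partial_deriv i f x)"
  using partial_deriv_eqI[OF bounded_linear.has_derivative[OF assms(1) differentiable_frechet[OF assms(2)]]]
  by (simp add: partial_deriv_def)

lemma differentiable_bounded_linear:
  assumes "bounded_linear L" "f differentiable at x"
  shows "(\<lambda>y. L (f y)) differentiable at x"
  using bounded_linear.has_derivative[OF assms(1) differentiable_frechet[OF assms(2)]]
  by (rule differentiableI)

lemma partial_deriv_add:
  "f differentiable at x \<Longrightarrow> g differentiable at x \<Longrightarrow>
    partial_deriv i (\<lambda>y. f y + g y) x = partial_deriv i f x + partial_deriv i g x"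
  using partial_deriv_eqI[OF has_derivative_add[OF differentiable_frechet differentiable_frechet]]
  by (simp add: partial_deriv_def)

lemma partial_deriv_diff:
  "f differentiable at x \<Longrightarrow> g differentiable at x \<Longrightarrow>
    partial_deriv i (\<lambda>y. f y - g y) x = partial_deriv i f x - partial_deriv i g x"
  using partial_deriv_eqI[OF has_derivative_diff[OF differentiable_frechet differentiable_frechet]]
  by (simp add: partial_deriv_def)

lemmas partial_deriv_minus = partial_deriv_bounded_linear[OF bounded_linear_minus[OF bounded_linear_ident]]

text \<open>Tensor identities hold only on a coordinate patch, so they have to be differentiated as
  identities on an open set.\<close>

lemma partial_deriv_cong:
  assumes "open U" "x \<in> U" "\<And>y. y \<in> U \<Longrightarrow> f y = g y"
  shows "partial_deriv i f x = partial_deriv i g x"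
proof -
  have "(f has_derivative f') (at x) \<longleftrightarrow> (g has_derivative f') (at x)" for f'
    using assms has_derivative_transform_within_open[of f f' x UNIV U g]
      has_derivative_transform_within_open[of g f' x UNIV U f] by auto
  then show ?thesis
    by (simp add: partial_deriv_def frechet_derivative_def)
qed

lemma differentiable_cong_open:
  assumes "open U" "x \<in> U" "\<And>y. y \<in> U \<Longrightarrow> f y = g y" "g differentiable at x"
  shows "f differentiable at x"
  using assms has_derivative_transform_within_open[of g _ x UNIV U f] unfolding differentiable_def by metis

text \<open>A single product rule that serves scalings and matrix, matrix-vector and outer
  products.\<close>

lemma partial_deriv_bilinear:
  fixes h :: "'b::euclidean_space \<Rightarrow> 'c::euclidean_space \<Rightarrow> 'd::euclidean_space"
  assumes "bilinear h" "f differentiable at x" "g differentiable at x"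
  shows "(\<lambda>y. h (f y) (g y)) differentiable at x"
    and "partial_deriv i (\<lambda>y. h (f y) (g y)) x = h (f x) (partial_deriv i g x) + h (partial_deriv i f x) (g x)"
proof -
  have "bounded_bilinear h"
    using assms(1) by (simp add: bilinear_conv_bounded_bilinear)
  from bounded_bilinear.FDERIV[OF this differentiable_frechet[OF assms(2)] differentiable_frechet[OF assms(3)]]
  show "(\<lambda>y. h (f y) (g y)) differentiable at x"
    and "partial_deriv i (\<lambda>y. h (f y) (g y)) x = h (f x) (partial_deriv i g x) + h (partial_deriv i f x) (g x)"
    by (auto intro: differentiableI dest: partial_deriv_eqI[where i = i] simp: partial_deriv_def)
qed

lemma bilinear_scaleR: "bilinear (\<lambda>r (v::'b::real_vector). r *\<^sub>R v)"
  by (auto intro!: linearI simp: bilinear_def algebra_simps)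

lemma scaleR_matrix_mult_right:
  fixes A :: "'a::real_algebra_1^'m^'n"
  shows "(r *\<^sub>R A) ** B = r *\<^sub>R (A ** B)"
  by (simp add: scalar_matrix_assoc)

lemma bilinear_matrix_mult: "bilinear (\<lambda>(A :: real^'m^'n) (B :: real^'k^'m). A ** B)"
  by (auto intro!: linearI simp: bilinear_def matrix_add_ldistrib matrix_add_rdistrib
      scaleR_matrix_mult_left scaleR_matrix_mult_right)

lemma bilinear_matrix_vector: "bilinear (\<lambda>(A :: real^'m^'n) (v :: real^'m). A *v v)"
  by (auto intro!: linearI simp: bilinear_def algebra_simps scaleR_matrix_vector_assoc)

lemma bilinear_outer: "bilinear (outer :: real^'m \<Rightarrow> real^'n \<Rightarrow> _)"
  by (auto intro!: linearI simp: bilinear_def outer_add_left outer_add_right outer_scaleR_left outer_scaleR_right)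

lemmas partial_deriv_scaleR = partial_deriv_bilinear[OF bilinear_scaleR]
lemmas partial_deriv_matrix_mult = partial_deriv_bilinear[OF bilinear_matrix_mult]
lemmas partial_deriv_matrix_vector = partial_deriv_bilinear[OF bilinear_matrix_vector]
lemmas partial_deriv_outer = partial_deriv_bilinear[OF bilinear_outer]
lemmas partial_deriv_mult = partial_deriv_bilinear[OF bilinear_scaleR[where 'b = real], unfolded real_scaleR_def]

lemma partial_deriv_vec_nth:
  "f differentiable at x \<Longrightarrow> partial_deriv i (\<lambda>y. f y $ a) x = partial_deriv i f x $ a"
  by (rule partial_deriv_bounded_linear[OF bounded_linear_vec_nth])

lemma differentiable_vec_nth: "f differentiable at x \<Longrightarrow> (\<lambda>y. f y $ a) differentiable at x"
  by (rule differentiable_bounded_linear[OF bounded_linear_vec_nth])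

lemma differentiable_vecI:
  fixes f :: "real^'n \<Rightarrow> 'b::euclidean_space^'m"
  assumes "\<And>a. (\<lambda>y. f y $ a) differentiable at x"
  shows "f differentiable at x"
proof -
  have "bounded_linear (axis a :: 'b \<Rightarrow> 'b^'m)" for a
    by (simp add: linear_conv_bounded_linear[symmetric])
      (auto intro!: linearI simp: vec_eq_iff axis_def)
  then have "(\<lambda>y. \<Sum>a\<in>UNIV. axis a (f y $ a)) differentiable at x"
    by (intro differentiable_sum ballI differentiable_bounded_linear[of "axis _"] assms) simp_all
  moreover have "(\<Sum>a\<in>UNIV. axis a (f y $ a)) = f y" for y
    by (simp add: vec_eq_iff axis_def if_distrib[of "\<lambda>z. z $ _"] cong: if_cong)
  ultimately show ?thesis by simp
qed

lemma bounded_linear_transpose: "bounded_linear (transpose :: real^'m^'k \<Rightarrow> _)"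
  by (auto intro!: linearI simp: linear_conv_bounded_linear[symmetric] transpose_def vec_eq_iff)

lemmas partial_deriv_transpose = partial_deriv_bounded_linear[OF bounded_linear_transpose]
lemmas differentiable_transpose = differentiable_bounded_linear[OF bounded_linear_transpose]

text \<open>Commuting second derivatives are part of the notion, so that vectors, products and
  exponentials of functions inherit them by algebra and Schwarz's theorem is invoked only for real
  components.\<close>

definition C2_on :: "(real^'n::finite) set \<Rightarrow> (real^'n \<Rightarrow> 'b::real_normed_vector) \<Rightarrow> bool" where
  "C2_on U f \<longleftrightarrow> (\<forall>x\<in>U. f differentiable at x \<and> (\<forall>i. partial_deriv i f differentiable at x) \<and>
     (\<forall>i j. partial_deriv i (partial_deriv j f) x = partial_deriv j (partial_deriv i f) x))"

lemma C2_onD: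
  assumes "C2_on U f" "x \<in> U"
  shows "f differentiable at x" "partial_deriv i f differentiable at x"
    "partial_deriv i (partial_deriv j f) x = partial_deriv j (partial_deriv i f) x"
  using assms by (auto simp: C2_on_def)

lemma C2_on_cong:
  assumes "open U" "C2_on U g" "\<And>y. y \<in> U \<Longrightarrow> f y = g y"
  shows "C2_on U f"
  unfolding C2_on_def
proof (intro ballI conjI allI)
  fix x i j assume x: "x \<in> U"
  have *: "partial_deriv i f y = partial_deriv i g y" if "y \<in> U" for y i
    by (rule partial_deriv_cong[OF assms(1) that assms(3)])
  show "f differentiable at x" "partial_deriv i f differentiable at x"
    using C2_onD[OF assms(2) x] differentiable_cong_open[OF assms(1) x] assms(3) * by blast+
  have "partial_deriv i (partial_deriv j f) x = partial_deriv i (partial_deriv j g) x" for i j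
    by (rule partial_deriv_cong[OF assms(1) x]) (rule *)
  then show "partial_deriv i (partial_deriv j f) x = partial_deriv j (partial_deriv i f) x"
    using C2_onD(3)[OF assms(2) x] by simp
qed

lemma C2_on_vecI:
  fixes f :: "real^'n \<Rightarrow> 'b::euclidean_space^'m"
  assumes U: "open U" and f: "\<And>a. C2_on U (\<lambda>y. f y $ a)"
  shows "C2_on U f"
  unfolding C2_on_def
proof (intro ballI conjI allI)
  fix x i j assume x: "x \<in> U"
  show D: "f differentiable at x" if "x \<in> U" for x
    using C2_onD[OF f that] by (intro differentiable_vecI)
  have *: "partial_deriv i f y $ a = partial_deriv i (\<lambda>y. f y $ a) y" if "y \<in> U" for y i a
    using D[OF that] by (simp add: partial_deriv_vec_nth)
  show D2: "partial_deriv i f differentiable at x" for i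
    by (rule differentiable_vecI, rule differentiable_cong_open[OF U x *]) (auto intro: C2_onD(2)[OF f x])
  have "partial_deriv i (partial_deriv j f) x $ a = partial_deriv i (partial_deriv j (\<lambda>y. f y $ a)) x" for i j a
    using partial_deriv_cong[OF U x *] by (simp add: partial_deriv_vec_nth[OF D2, symmetric])
  then show "partial_deriv i (partial_deriv j f) x = partial_deriv j (partial_deriv i f) x"
    using C2_onD(3)[OF f x] by (simp add: vec_eq_iff)
qed

text \<open>Together with \<open>C2_on_exp\<close> this gives a conformally rescaled metric the
  regularity of the original one.\<close>

lemma C2_on_scaleR:
  fixes f :: "real^'n \<Rightarrow> 'b::euclidean_space"
  assumes U: "open U" and s: "C2_on U s" and f: "C2_on U f"
  shows "C2_on U (\<lambda>y. s y *\<^sub>R f y)"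
  unfolding C2_on_def
proof (intro ballI conjI allI)
  fix x i j assume x: "x \<in> U"
  note D = C2_onD[OF s] C2_onD[OF f]
  show "(\<lambda>y. s y *\<^sub>R f y) differentiable at x"
    using D x by (intro partial_deriv_scaleR)
  have *: "partial_deriv i (\<lambda>y. s y *\<^sub>R f y) y = s y *\<^sub>R partial_deriv i f y + partial_deriv i s y *\<^sub>R f y"
    if "y \<in> U" for y i
    using D that by (intro partial_deriv_scaleR)
  have d: "(\<lambda>y. s y *\<^sub>R partial_deriv i f y) differentiable at x"
      "(\<lambda>y. partial_deriv i s y *\<^sub>R f y) differentiable at x" for i
    using D x by (auto intro!: partial_deriv_scaleR)
  show "partial_deriv i (\<lambda>y. s y *\<^sub>R f y) differentiable at x"
    by (rule differentiable_cong_open[OF U x *]) (auto intro!: differentiable_add d)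
  have "partial_deriv i (partial_deriv j (\<lambda>y. s y *\<^sub>R f y)) x =
      (s x *\<^sub>R partial_deriv i (partial_deriv j f) x + partial_deriv i s x *\<^sub>R partial_deriv j f x) +
      (partial_deriv j s x *\<^sub>R partial_deriv i f x + partial_deriv i (partial_deriv j s) x *\<^sub>R f x)" for i j
  proof -
    have "partial_deriv i (partial_deriv j (\<lambda>y. s y *\<^sub>R f y)) x =
        partial_deriv i (\<lambda>y. s y *\<^sub>R partial_deriv j f y + partial_deriv j s y *\<^sub>R f y) x"
      by (rule partial_deriv_cong[OF U x *])
    then show ?thesis
      using D x by (simp add: partial_deriv_add d partial_deriv_scaleR)
  qed
  then show "partial_deriv i (partial_deriv j (\<lambda>y. s y *\<^sub>R f y)) x = partial_deriv j (partial_deriv i (\<lambda>y. s y *\<^sub>R f y)) x"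
    using D(3,6)[OF x, of i j] by simp
qed

lemma partial_deriv_exp:
  assumes "w differentiable at x"
  shows "(\<lambda>y. exp (2 * w y :: real)) differentiable at x"
    "partial_deriv i (\<lambda>y. exp (2 * w y)) x = exp (2 * w x) * (2 * partial_deriv i w x)"
proof -
  have "((\<lambda>y. exp (2 * w y)) has_derivative (\<lambda>h. exp (2 * w x) * (2 * frechet_derivative w (at x) h))) (at x)"
    using differentiable_frechet[OF assms] by (auto intro!: derivative_eq_intros)
  then show "(\<lambda>y. exp (2 * w y :: real)) differentiable at x"
    "partial_deriv i (\<lambda>y. exp (2 * w y)) x = exp (2 * w x) * (2 * partial_deriv i w x)"
    by (auto intro: differentiableI dest: partial_deriv_eqI[where i = i] simp: partial_deriv_def)
qed

lemma C2_on_exp: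
  assumes U: "open U" and w: "C2_on U w"
  shows "C2_on U (\<lambda>y. exp (2 * w y :: real))"
  unfolding C2_on_def
proof (intro ballI conjI allI)
  fix x i j assume x: "x \<in> U"
  note D = C2_onD[OF w]
  show "(\<lambda>y. exp (2 * w y)) differentiable at x"
    using D x by (intro partial_deriv_exp)
  have *: "partial_deriv i (\<lambda>y. exp (2 * w y)) y = exp (2 * w y) * (2 * partial_deriv i w y)"
    if "y \<in> U" for y i
    using D that by (intro partial_deriv_exp)
  have d: "(\<lambda>y. exp (2 * w y)) differentiable at x" "(\<lambda>y. 2 * partial_deriv i w y) differentiable at x" for i
    using D x by (auto intro!: partial_deriv_exp)
  show "partial_deriv i (\<lambda>y. exp (2 * w y)) differentiable at x"
    by (rule differentiable_cong_open[OF U x *]) (auto intro!: partial_deriv_mult d)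
  have "partial_deriv i (partial_deriv j (\<lambda>y. exp (2 * w y))) x =
      exp (2 * w x) * (2 * partial_deriv i (partial_deriv j w) x) +
      exp (2 * w x) * (2 * partial_deriv i w x) * (2 * partial_deriv j w x)" for i j
  proof -
    have "partial_deriv i (partial_deriv j (\<lambda>y. exp (2 * w y))) x =
        partial_deriv i (\<lambda>y. exp (2 * w y) * (2 * partial_deriv j w y)) x"
      by (rule partial_deriv_cong[OF U x *])
    then show ?thesis
      using D x by (simp add: partial_deriv_mult d partial_deriv_exp)
  qed
  then show "partial_deriv i (partial_deriv j (\<lambda>y. exp (2 * w y))) x = partial_deriv j (partial_deriv i (\<lambda>y. exp (2 * w y))) x"
    using D(3)[OF x, of i j] by simp
qed

section \<open>Symmetry of the second partial derivatives of smooth functions\<close>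

lemma smooth_on_partial_deriv:
  assumes "smooth_on S f"
  shows "smooth_on S (partial_deriv i f)"
proof -
  have "iter_partial_deriv is (partial_deriv i f) = iter_partial_deriv (is @ [i]) f" for "is"
    by (induction "is") auto
  then show ?thesis
    using assms by (simp add: smooth_on_def)
qed

lemma smooth_on_differentiable: "smooth_on S f \<Longrightarrow> x \<in> S \<Longrightarrow> f differentiable at x"
  unfolding smooth_on_def using iter_partial_deriv.simps(1) by metis

lemma line_derivative:
  fixes f :: "real^'n \<Rightarrow> real"
  assumes "f differentiable at (p + s *\<^sub>R axis i 1)"
  shows "((\<lambda>s. f (p + s *\<^sub>R axis i 1)) has_real_derivative partial_deriv i f (p + s *\<^sub>R axis i 1)) (at s)"
proof -
  let ?D = "frechet_derivative f (at (p + s *\<^sub>R axis i 1))"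
  have "((\<lambda>s. p + s *\<^sub>R axis i 1) has_derivative (\<lambda>h. h *\<^sub>R axis i 1)) (at s)"
    by (auto intro!: derivative_eq_intros)
  from has_derivative_compose[OF this differentiable_frechet[OF assms]]
  have "((\<lambda>s. f (p + s *\<^sub>R axis i 1)) has_derivative (\<lambda>h. ?D (h *\<^sub>R axis i 1))) (at s)" .
  moreover have "?D (h *\<^sub>R axis i 1) = partial_deriv i f (p + s *\<^sub>R axis i 1) * h" for h
    using linear_frechet_derivative[OF assms] by (simp add: linear_scale partial_deriv_def)
  ultimately show ?thesis
    by (simp add: has_field_derivative_def mult_commute_abs)
qed

text \<open>The second difference over a square of side \<open>t\<close> is evaluated by the mean
  value theorem, first in direction \<open>i\<close> and then in direction \<open>j\<close>. The
  left side is symmetric in the two directions, the right side fixes their order.\<close>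

lemma mixed_difference:
  fixes f :: "real^'n \<Rightarrow> real"
  assumes t: "0 < t"
    and f: "\<And>y. dist x y \<le> 2 * t \<Longrightarrow> f differentiable at y \<and> partial_deriv i f differentiable at y"
  obtains z where "dist x z \<le> 2 * t"
    "f (x + t *\<^sub>R axis i 1 + t *\<^sub>R axis j 1) - f (x + t *\<^sub>R axis i 1) - f (x + t *\<^sub>R axis j 1) + f x
      = t * t * partial_deriv j (partial_deriv i f) z"
proof -
  have near: "dist x (x + u *\<^sub>R axis i 1 + v *\<^sub>R axis j 1) \<le> 2 * t"
      if "0 \<le> u" "u \<le> t" "0 \<le> v" "v \<le> t" for u v
  proof -
    have "dist x (x + u *\<^sub>R axis i 1 + v *\<^sub>R axis j 1) = norm (u *\<^sub>R axis i 1 + v *\<^sub>R axis j (1::real) :: real^'n)"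
      by (subst dist_commute) (simp add: dist_norm add.assoc)
    also have "\<dots> \<le> u + v"
      using norm_triangle_ineq[of "u *\<^sub>R axis i 1 :: real^'n" "v *\<^sub>R axis j 1"] that by simp
    finally show ?thesis using that by simp
  qed
  have swap: "x + t *\<^sub>R axis j 1 + s *\<^sub>R axis i 1 = x + s *\<^sub>R axis i 1 + t *\<^sub>R axis j 1" for s
    by (simp add: algebra_simps)
  have 1: "((\<lambda>s. f (x + t *\<^sub>R axis j 1 + s *\<^sub>R axis i 1) - f (x + s *\<^sub>R axis i 1)) has_real_derivative
      partial_deriv i f (x + t *\<^sub>R axis j 1 + s *\<^sub>R axis i 1) - partial_deriv i f (x + s *\<^sub>R axis i 1)) (at s)"
    if "0 \<le> s" "s \<le> t" for s
  proof (intro DERIV_diff line_derivative)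
    show "f differentiable at (x + t *\<^sub>R axis j 1 + s *\<^sub>R axis i 1)"
      unfolding swap using near[of s t] that t f by auto
    show "f differentiable at (x + s *\<^sub>R axis i 1)"
      using near[of s 0] that t f by auto
  qed
  obtain \<xi> where \<xi>: "0 < \<xi>" "\<xi> < t"
    "f (x + t *\<^sub>R axis j 1 + t *\<^sub>R axis i 1) - f (x + t *\<^sub>R axis i 1)
       - (f (x + t *\<^sub>R axis j 1 + 0 *\<^sub>R axis i 1) - f (x + 0 *\<^sub>R axis i 1))
      = (t - 0) * (partial_deriv i f (x + t *\<^sub>R axis j 1 + \<xi> *\<^sub>R axis i 1) - partial_deriv i f (x + \<xi> *\<^sub>R axis i 1))"
    using MVT2[OF t 1] by blast
  have 2: "((\<lambda>s. partial_deriv i f (x + \<xi> *\<^sub>R axis i 1 + s *\<^sub>R axis j 1)) has_real_derivative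
      partial_deriv j (partial_deriv i f) (x + \<xi> *\<^sub>R axis i 1 + s *\<^sub>R axis j 1)) (at s)"
    if "0 \<le> s" "s \<le> t" for s
    by (rule line_derivative) (use near[of \<xi> s] that \<xi> f in auto)
  obtain \<eta> where \<eta>: "0 < \<eta>" "\<eta> < t"
    "partial_deriv i f (x + \<xi> *\<^sub>R axis i 1 + t *\<^sub>R axis j 1) - partial_deriv i f (x + \<xi> *\<^sub>R axis i 1 + 0 *\<^sub>R axis j 1)
      = (t - 0) * partial_deriv j (partial_deriv i f) (x + \<xi> *\<^sub>R axis i 1 + \<eta> *\<^sub>R axis j 1)"
    using MVT2[OF t 2] by blast
  show ?thesis
    by (rule that[of "x + \<xi> *\<^sub>R axis i 1 + \<eta> *\<^sub>R axis j 1"])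
      (use near[of \<xi> \<eta>] \<xi> \<eta> in \<open>simp_all add: swap\<close>)
qed

text \<open>By symmetry of the second difference, some value of one mixed partial near
  \<open>x\<close> equals some value of the other near \<open>x\<close>. Continuity of both then
  rules out a gap at \<open>x\<close>.\<close>

lemma partial_deriv_commute:
  fixes f :: "real^'n \<Rightarrow> real"
  assumes S: "open S" "x \<in> S" and f: "smooth_on S f"
  shows "partial_deriv i (partial_deriv j f) x = partial_deriv j (partial_deriv i f) x"
proof (rule ccontr)
  let ?A = "\<lambda>i j. partial_deriv i (partial_deriv j f)"
  define e where "e = \<bar>?A i j x - ?A j i x\<bar> / 2"
  assume "\<not> ?thesis"
  then have e: "e > 0" by (simp add: e_def)
  obtain d0 where d0: "d0 > 0" "ball x d0 \<subseteq> S"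
    using S open_contains_ball by blast
  have "\<exists>d>0. \<forall>y. dist y x < d \<longrightarrow> dist (?A i j y) (?A i j x) < e" for i j
    using differentiable_imp_continuous_within[OF smooth_on_differentiable[OF
        smooth_on_partial_deriv[OF smooth_on_partial_deriv[OF f]] S(2)]] e
    unfolding continuous_at_eps_delta by blast
  then obtain d where d: "\<And>i j. d i j > 0" "\<And>i j y. dist y x < d i j \<Longrightarrow> dist (?A i j y) (?A i j x) < e"
    by metis
  \<comment> \<open>A third of the smallest radius keeps the distance bound \<open>2 * t\<close> of
    \<open>mixed_difference\<close> strictly inside all three balls.\<close>
  define t where "t = Min {d0, d i j, d j i} / 3"
  have t: "t > 0" "2 * t < d0" "2 * t < d i j" "2 * t < d j i"
    using d0 d(1)[of i j] d(1)[of j i] by (auto simp: t_def min_def)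
  have diff: "f differentiable at y \<and> partial_deriv l f differentiable at y" if "dist x y \<le> 2 * t" for y l
    using that t d0 smooth_on_differentiable[OF f] smooth_on_differentiable[OF smooth_on_partial_deriv[OF f]]
    by (meson mem_ball order_le_less_trans subset_iff)
  obtain z where z: "dist x z \<le> 2 * t"
    "f (x + t *\<^sub>R axis i 1 + t *\<^sub>R axis j 1) - f (x + t *\<^sub>R axis i 1) - f (x + t *\<^sub>R axis j 1) + f x
      = t * t * ?A j i z"
    using mixed_difference[OF t(1) diff] by metis
  obtain z' where z': "dist x z' \<le> 2 * t"
    "f (x + t *\<^sub>R axis j 1 + t *\<^sub>R axis i 1) - f (x + t *\<^sub>R axis j 1) - f (x + t *\<^sub>R axis i 1) + f x
      = t * t * ?A i j z'"
    using mixed_difference[OF t(1) diff] by metis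
  have "t * t * ?A j i z = t * t * ?A i j z'"
    using z(2) z'(2) by (simp add: algebra_simps)
  then have "?A j i z = ?A i j z'"
    using t by simp
  moreover have "dist (?A j i z) (?A j i x) < e" "dist (?A i j z') (?A i j x) < e"
    using d(2)[of z j i] d(2)[of z' i j] z(1) z'(1) t by (auto simp: dist_commute)
  ultimately show False
    by (auto simp: dist_real_def e_def abs_if split: if_splits)
qed

lemma smooth_on_C2:
  fixes f :: "real^'n \<Rightarrow> real"
  assumes "open S" "smooth_on S f"
  shows "C2_on S f"
  using assms partial_deriv_commute smooth_on_differentiable smooth_on_partial_deriv
  unfolding C2_on_def by metis

section \<open>Inverses and determinants of matrices and their derivatives\<close>

lemma matrix_inv_unique:
  fixes A B :: "real^'n::finite^'n"
  assumes "A ** B = mat 1" "B ** A = mat 1"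
  shows "matrix_inv A = B"
proof -
  have *: "A ** matrix_inv A = mat 1 \<and> matrix_inv A ** A = mat 1"
    unfolding matrix_inv_def using assms
    by (intro someI[where P = "\<lambda>B. A ** B = mat 1 \<and> B ** A = mat 1" and x = B] conjI)
  then have "matrix_inv A = (B ** A) ** matrix_inv A"
    using assms by simp
  also have "\<dots> = B"
    unfolding matrix_mul_assoc[symmetric] by (simp add: *)
  finally show ?thesis .
qed

lemma matrix_inv_mult:
  fixes A :: "real^'n::finite^'n"
  assumes "invertible A"
  shows "A ** matrix_inv A = mat 1" "matrix_inv A ** A = mat 1"
  using assms matrix_inv_unique[of A] unfolding invertible_def by metis+

lemma matrix_inv_scaleR:
  fixes A :: "real^'n::finite^'n"
  assumes "invertible A" "r \<noteq> 0"
  shows "matrix_inv (r *\<^sub>R A) = (1 / r) *\<^sub>R matrix_inv A"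
  by (rule matrix_inv_unique)
    (simp_all add: scaleR_matrix_mult_left scaleR_matrix_mult_right matrix_inv_mult assms)

lemma matrix_inv_transpose:
  fixes A :: "real^'n::finite^'n"
  assumes "invertible A" "Finite_Cartesian_Product.transpose A = A"
  shows "Finite_Cartesian_Product.transpose (matrix_inv A) = matrix_inv A"
proof -
  have "matrix_inv A = Finite_Cartesian_Product.transpose (matrix_inv A)"
    by (rule matrix_inv_unique)
      (metis assms matrix_inv_mult matrix_transpose_mul transpose_mat)+
  then show ?thesis ..
qed

lemma matrix_mult_zero [simp]: "0 ** A = 0" "A ** 0 = 0" for A :: "'a::semiring_1^'m^'n"
  by (simp_all add: matrix_matrix_mult_def vec_eq_iff)

lemma trace_scaleR: "trace (r *\<^sub>R A) = r * trace (A :: real^'n::finite^'n)"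
  by (simp add: trace_def sum_distrib_left)

lemma trace_transpose: "trace (Finite_Cartesian_Product.transpose A) = trace A"
  by (simp add: trace_def Finite_Cartesian_Product.transpose_def)

lemma has_derivative_det:
  fixes G :: "'a::real_normed_vector \<Rightarrow> real^'n::finite^'n"
  assumes "(G has_derivative G') (at x)"
  shows "((\<lambda>y. det (G y)) has_derivative
    (\<lambda>h. \<Sum>p | p permutes UNIV. of_int (sign p) *
      (\<Sum>i\<in>UNIV. G' h $ i $ p i * (\<Prod>j\<in>UNIV - {i}. G x $ j $ p j)))) (at x)"
proof -
  have "((\<lambda>y. G y $ i $ j) has_derivative (\<lambda>h. G' h $ i $ j)) (at x)" for i j
    by (intro bounded_linear.has_derivative[OF bounded_linear_vec_nth] assms)
  then show ?thesis
    unfolding det_def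
    by (intro has_derivative_sum has_derivative_mult_right has_derivative_prod)
qed

text \<open>A permutation other than the identity moves at least two indices, so after one factor is
  differentiated an off-diagonal zero of the identity matrix remains in the product.\<close>

lemma has_derivative_det_at_mat_1:
  fixes G :: "'a::real_normed_vector \<Rightarrow> real^'n::finite^'n"
  assumes "(G has_derivative G') (at x)" "G x = mat 1"
  shows "((\<lambda>y. det (G y)) has_derivative (\<lambda>h. trace (G' h))) (at x)"
proof -
  have "(\<Sum>i\<in>UNIV. G' h $ i $ p i * (\<Prod>j\<in>UNIV - {i}. mat 1 $ j $ p j)) = (if p = id then trace (G' h) else 0)"
    if p: "p permutes (UNIV :: 'n set)" for p h
  proof (cases "p = id")
    case False
    have "(\<Prod>j\<in>UNIV - {i}. mat 1 $ j $ p j) = (0::real)" for i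
    proof (rule ccontr)
      assume "\<not> ?thesis"
      then have *: "p j = j" if "j \<noteq> i" for j
        using that by (auto simp: mat_def split: if_splits)
      then have "p i = i"
        using p by (metis permutes_def)
      with * have "p j = j" for j
        by (cases "j = i") auto
      then have "p = id"
        by (auto simp: fun_eq_iff)
      with False show False ..
    qed
    then show ?thesis
      using False by (simp only: mult_zero_right sum.neutral_const if_False)
  qed (simp add: mat_def trace_def)
  then have "(\<Sum>p | p permutes (UNIV :: 'n set). of_int (sign p) *
      (\<Sum>i\<in>UNIV. G' h $ i $ p i * (\<Prod>j\<in>UNIV - {i}. G x $ j $ p j)))
      = (\<Sum>p | p permutes (UNIV :: 'n set). if p = id then trace (G' h) else 0)" for h
    unfolding assms(2) by (intro sum.cong) auto
  then show ?thesis
    using has_derivative_det[OF assms(1)] by (simp add: permutes_id)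
qed

text \<open>Jacobi's formula, reduced to the identity matrix by multiplying with the inverse frozen
  at the point \<open>x\<close>.\<close>

lemma partial_deriv_det:
  fixes G :: "real^'n::finite \<Rightarrow> real^'m::finite^'m"
  assumes G: "G differentiable at x" "invertible (G x)"
  shows "(\<lambda>y. det (G y)) differentiable at x"
    and "partial_deriv i (\<lambda>y. det (G y)) x = det (G x) * trace (matrix_inv (G x) ** partial_deriv i G x)"
proof -
  let ?I = "matrix_inv (G x)"
  have 1: "(\<lambda>y. ?I ** G y) differentiable at x"
      "partial_deriv i (\<lambda>y. ?I ** G y) x = ?I ** partial_deriv i G x"
    using partial_deriv_matrix_mult(1)[OF differentiable_const G(1)]
      partial_deriv_matrix_mult(2)[OF differentiable_const G(1)] by simp_all
  have "((\<lambda>y. det (?I ** G y)) has_derivative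
      (\<lambda>h. trace (frechet_derivative (\<lambda>y. ?I ** G y) (at x) h))) (at x)"
    by (rule has_derivative_det_at_mat_1) (use G 1 in \<open>auto intro: differentiable_frechet simp: matrix_inv_mult\<close>)
  then have "((\<lambda>y. det (G x) * det (?I ** G y)) has_derivative
      (\<lambda>h. det (G x) * trace (frechet_derivative (\<lambda>y. ?I ** G y) (at x) h))) (at x)"
    by (rule has_derivative_mult_right)
  also have "(\<lambda>y. det (G x) * det (?I ** G y)) = (\<lambda>y. det (G y))"
    using arg_cong[OF matrix_inv_mult(1)[OF G(2)], of det] by (simp add: det_mul mult.assoc[symmetric])
  finally have D: "((\<lambda>y. det (G y)) has_derivative
      (\<lambda>h. det (G x) * trace (frechet_derivative (\<lambda>y. ?I ** G y) (at x) h))) (at x)" .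
  then show "(\<lambda>y. det (G y)) differentiable at x"
    by (rule differentiableI)
  show "partial_deriv i (\<lambda>y. det (G y)) x = det (G x) * trace (?I ** partial_deriv i G x)"
    using partial_deriv_eqI[OF D, of i] 1(2) by (simp add: partial_deriv_def)
qed

text \<open>The determinant of a metric can have either sign, depending on the signature; hence the
  absolute value and the two cases.\<close>

lemma DERIV_abs_powr:
  fixes d q :: real
  assumes "d \<noteq> 0"
  shows "((\<lambda>d. \<bar>d\<bar> powr q) has_real_derivative q * \<bar>d\<bar> powr q / d) (at d)"
proof (cases "d > 0")
  case True
  have "((\<lambda>d. d powr q) has_real_derivative q * \<bar>d\<bar> powr q / d) (at d)"
    using True by (auto intro!: derivative_eq_intros simp: powr_diff)
  then show ?thesis
    by (rule has_field_derivative_transform_within_open[where S = "{0<..}"]) (use True in auto)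
next
  case False
  have "((\<lambda>d. (- d) powr q) has_real_derivative q * \<bar>d\<bar> powr q / d) (at d)"
    using False assms by (auto intro!: derivative_eq_intros simp: powr_diff)
  then show ?thesis
    by (rule has_field_derivative_transform_within_open[where S = "{..<0}"]) (use False assms in auto)
qed

lemma partial_deriv_abs_powr:
  fixes f :: "real^'n \<Rightarrow> real"
  assumes "f differentiable at x" "f x \<noteq> 0"
  shows "(\<lambda>y. \<bar>f y\<bar> powr q) differentiable at x"
    and "partial_deriv i (\<lambda>y. \<bar>f y\<bar> powr q) x = q * \<bar>f x\<bar> powr q / f x * partial_deriv i f x"
proof -
  have "((\<lambda>y. \<bar>f y\<bar> powr q) has_derivative (\<lambda>h. q * \<bar>f x\<bar> powr q / f x * frechet_derivative f (at x) h)) (at x)"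
    using has_derivative_compose[OF differentiable_frechet[OF assms(1)]
        DERIV_abs_powr[OF assms(2), of q, unfolded has_field_derivative_def]] by simp
  then show "(\<lambda>y. \<bar>f y\<bar> powr q) differentiable at x"
    and "partial_deriv i (\<lambda>y. \<bar>f y\<bar> powr q) x = q * \<bar>f x\<bar> powr q / f x * partial_deriv i f x"
    by (blast intro: differentiableI, simp add: partial_deriv_eqI partial_deriv_def[of i f])
qed

text \<open>By Cramer's rule every entry of the inverse is a quotient of two determinants.\<close>

lemma differentiable_matrix_inv:
  fixes G :: "real^'n::finite \<Rightarrow> real^'m::finite^'m"
  assumes U: "open U" "x \<in> U" and G: "G differentiable at x" "\<And>y. y \<in> U \<Longrightarrow> invertible (G y)"
  shows "(\<lambda>y. matrix_inv (G y)) differentiable at x"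
proof (intro differentiable_vecI)
  fix k l
  let ?N = "\<lambda>y. (\<chi> i j. if j = k then axis l 1 $ i else G y $ i $ j)"
  show "(\<lambda>y. matrix_inv (G y) $ k $ l) differentiable at x"
  proof (rule differentiable_cong_open[OF U])
    fix y assume "y \<in> U"
    then have y: "invertible (G y)"
      by (rule G)
    then have "G y *v (matrix_inv (G y) *v axis l 1) = axis l 1"
      by (simp add: matrix_vector_mul_assoc matrix_inv_mult)
    then have "matrix_inv (G y) *v axis l 1 = (\<chi> k. det (\<chi> i j. if j = k then axis l 1 $ i else G y $ i $ j) / det (G y))"
      using y by (subst (asm) cramer) (auto simp: invertible_det_nz)
    then show "matrix_inv (G y) $ k $ l = det (?N y) / det (G y)"
      by (simp add: vec_eq_iff matrix_vector_mult_basis column_def)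
  next
    have "?N differentiable at x"
    proof (intro differentiable_vecI)
      fix i j
      show "(\<lambda>y. ?N y $ i $ j) differentiable at x"
        using differentiable_vec_nth[OF differentiable_vec_nth[OF G(1)]] by (cases "j = k") simp_all
    qed
    then have "(\<lambda>y. det (?N y)) differentiable at x"
      using has_derivative_det[OF differentiable_frechet] by (blast intro: differentiableI)
    then show "(\<lambda>y. det (?N y) / det (G y)) differentiable at x"
      using partial_deriv_det(1)[OF G(1)] G(2)[OF U(2)]
      by (intro differentiable_divide) (auto simp: invertible_det_nz)
  qed
qed

section \<open>Curvature-like tensors\<close>

lemma transpose_add:
  fixes A B :: "'a::ab_group_add^'m^'n"
  shows "transpose (A + B) = transpose A + transpose B"
    and "transpose (A - B) = transpose A - transpose B"
    and "transpose (- A) = - transpose A"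
  by (simp_all add: transpose_def vec_eq_iff)

lemma matrix_diff_mult:
  fixes A B :: "'a::ring_1^'m^'n" and C D :: "'a^'k^'m"
  shows "A ** (C - D) = A ** C - A ** D" "(A - B) ** C = A ** C - B ** C"
    "(- A) ** C = - (A ** C)" "A ** (- C) = - (A ** C)"
  by (simp_all add: matrix_matrix_mult_def vec_eq_iff algebra_simps sum_subtractf sum_negf)

lemmas matrix_distribs = matrix_add_ldistrib matrix_add_rdistrib matrix_diff_mult transpose_add
  matrix_transpose_mul

lemma sum_matrix_mult_right: "(\<Sum>i\<in>I. B i) ** A = (\<Sum>i\<in>I. B i ** A)"
  for A :: "'a::comm_semiring_1^'k^'m"
  by (auto simp: matrix_matrix_mult_def vec_eq_iff sum_distrib_right intro: sum.swap)

lemma matrix_vector_mult_minus: "(- A) *v x = - (A *v x)" for A :: "'a::ring_1^'m^'n"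
  by (simp add: matrix_vector_mult_def vec_eq_iff sum_negf)

lemma transpose_sum: "transpose (\<Sum>i\<in>I. A i) = (\<Sum>i\<in>I. transpose (A i))"
  by (simp add: transpose_def vec_eq_iff)

lemma symmetric_matrix_nth:
  assumes "transpose A = A"
  shows "A $ i $ j = A $ j $ i"
proof -
  have "A $ i $ j = transpose A $ j $ i"
    by (simp add: transpose_def)
  then show ?thesis
    by (simp only: assms)
qed

text \<open>The matrices are skew with respect to \<open>G\<close> and satisfy the first Bianchi
  identity. Both conditions are linear, so they pass from the Riemann tensor and the Kulkarni-Nomizu
  term to the Weyl tensor.\<close>

definition curvature_like :: "real^'n^'n \<Rightarrow> ('n::finite \<Rightarrow> 'n \<Rightarrow> real^'n^'n) \<Rightarrow> bool" where
  "curvature_like G F \<longleftrightarrow> (\<forall>a b. G ** F a b = - (transpose (F a b) ** G)) \<and>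
     (\<forall>a b c d. F a b $ d $ c + F b c $ d $ a + F c a $ d $ b = 0)"

lemma curvature_like_diff:
  assumes "curvature_like G E" "curvature_like G F"
  shows "curvature_like G (\<lambda>a b. E a b - F a b)"
  unfolding curvature_like_def
proof (intro conjI allI)
  fix a b c d
  show "G ** (E a b - F a b) = - (transpose (E a b - F a b) ** G)"
    using assms by (simp add: curvature_like_def matrix_distribs)
  have "E a b $ d $ c + E b c $ d $ a + E c a $ d $ b = 0" "F a b $ d $ c + F b c $ d $ a + F c a $ d $ b = 0"
    using assms by (simp_all add: curvature_like_def)
  then show "(E a b - F a b) $ d $ c + (E b c - F b c) $ d $ a + (E c a - F c a) $ d $ b = 0"
    by simp
qed

lemma two_form_nth: "two_form F u w $ i $ j = (\<Sum>a\<in>UNIV. \<Sum>b\<in>UNIV. u $ a * w $ b * F a b $ i $ j)"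
  by (simp add: two_form_def)

lemma two_form_add: "two_form (\<lambda>a b. E a b + F a b) u w = two_form E u w + two_form F u w"
  by (simp add: two_form_def scaleR_right_distrib sum.distrib)

lemma two_form_conjugate: "two_form (\<lambda>a b. G ** F a b ** Gi) u w = G ** two_form F u w ** Gi"
  by (simp add: two_form_def sum_matrix_mult_right sum_matrix_mult_left scaleR_matrix_mult_left scaleR_matrix_mult_right)

lemma sum_rotate3:
  "(\<Sum>a\<in>A. \<Sum>b\<in>B. \<Sum>c\<in>C. f a b c) = (\<Sum>b\<in>B. \<Sum>c\<in>C. \<Sum>a\<in>A. f a b c)"
  by (subst sum.swap, rule sum.cong[OF refl], rule sum.swap)

lemma curvature_like_bianchi:
  assumes "curvature_like G F"
  shows "bianchi (two_form F)"
  unfolding bianchi_def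
proof (intro allI)
  fix u v w
  have 1: "(two_form F u v *v w) $ d = (\<Sum>a\<in>UNIV. \<Sum>b\<in>UNIV. \<Sum>c\<in>UNIV. u $ a * v $ b * w $ c * F a b $ d $ c)"
    for u v w d
  proof -
    have "(two_form F u v *v w) $ d = (\<Sum>c\<in>UNIV. \<Sum>a\<in>UNIV. \<Sum>b\<in>UNIV. u $ a * v $ b * w $ c * F a b $ d $ c)"
      by (simp add: matrix_vector_mult_def two_form_nth sum_distrib_left sum_distrib_right mult_ac)
    also have "\<dots> = (\<Sum>a\<in>UNIV. \<Sum>b\<in>UNIV. \<Sum>c\<in>UNIV. u $ a * v $ b * w $ c * F a b $ d $ c)"
      by (rule sum_rotate3)
    finally show ?thesis .
  qed
  have 2: "(two_form F v w *v u) $ d = (\<Sum>a\<in>UNIV. \<Sum>b\<in>UNIV. \<Sum>c\<in>UNIV. v $ b * w $ c * u $ a * F b c $ d $ a)" for d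
    unfolding 1 by (rule sum_rotate3[symmetric])
  have 3: "(two_form F w u *v v) $ d = (\<Sum>a\<in>UNIV. \<Sum>b\<in>UNIV. \<Sum>c\<in>UNIV. w $ c * u $ a * v $ b * F c a $ d $ b)" for d
    unfolding 1 by (rule sum_rotate3)
  have "(two_form F u v *v w + two_form F v w *v u + two_form F w u *v v) $ d =
      (\<Sum>a\<in>UNIV. \<Sum>b\<in>UNIV. \<Sum>c\<in>UNIV. u $ a * v $ b * w $ c * (F a b $ d $ c + F b c $ d $ a + F c a $ d $ b))" for d
    unfolding vector_add_component 1[of u] 2 3
    by (simp add: sum.distrib[symmetric] algebra_simps)
  also have "\<dots>d = 0" for d
    using assms by (simp add: curvature_like_def)
  finally show "two_form F u v *v w + two_form F v w *v u + two_form F w u *v v = 0"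
    by (simp add: vec_eq_iff)
qed

text \<open>Skewness turns the action on the lowered vector \<open>G *v w\<close> into minus the
  lowered action on \<open>w\<close>, so this is the Bianchi identity multiplied by
  \<open>G\<close>.\<close>

lemma curvature_like_cobianchi:
  assumes F: "curvature_like G F"
  shows "cobianchi ((*v) G) (two_form F)"
  unfolding cobianchi_def
proof (intro allI)
  fix u v w
  have *: "(G *v w) v* two_form F u v = - (G *v (two_form F u v *v w))" for u v w
  proof -
    have "G ** two_form F u v = - (transpose (two_form F u v) ** G)"
      using F by (simp add: two_form_def sum_matrix_mult_left sum_matrix_mult_right scaleR_matrix_mult_left
          scaleR_matrix_mult_right sum_negf curvature_like_def transpose_sum transpose_scalar)
    then have "transpose (two_form F u v) ** G = - (G ** two_form F u v)"
      by simp
    then have "transpose (two_form F u v) *v (G *v w) = - (G *v (two_form F u v *v w))"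
      by (metis matrix_vector_mul_assoc matrix_vector_mult_minus)
    then show ?thesis by simp
  qed
  have "two_form F u v *v w + two_form F v w *v u + two_form F w u *v v = 0"
    using curvature_like_bianchi[OF F] by (simp add: bianchi_def)
  then have "G *v (two_form F u v *v w) + G *v (two_form F v w *v u) + G *v (two_form F w u *v v) = 0"
    by (metis matrix_vector_right_distrib matrix_vector_mult_0_right)
  then show "(G *v w) v* two_form F u v + (G *v u) v* two_form F v w + (G *v v) v* two_form F w u = 0"
    by (simp only: * minus_add_distrib[symmetric] neg_equal_0_iff_equal)
qed

text \<open>As an endomorphism of the tangent space, that is, with the third index raised.\<close>

definition kulkarni_nomizu :: "real^'n^'n \<Rightarrow> real^'n^'n \<Rightarrow> 'n::finite \<Rightarrow> 'n \<Rightarrow> real^'n^'n" where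
  "kulkarni_nomizu G P a b = outer (axis a 1) (P $ b) - outer (axis b 1) (P $ a) +
     (outer (matrix_inv G *v P $ a) (G $ b) - outer (matrix_inv G *v P $ b) (G $ a))"

context
  fixes G P :: "real^'n::finite^'n"
  assumes G: "transpose G = G" "invertible G" and P: "transpose P = P"
begin

lemma kulkarni_nomizu_curvature_like: "curvature_like G (kulkarni_nomizu G P)"
proof -
  have G': "G *v (matrix_inv G *v w) = w" for w
    by (simp add: matrix_vector_mul_assoc matrix_inv_mult G)
  have Ga: "G *v axis a 1 = G $ a" for a
    using symmetric_matrix_nth[OF G(1)] by (simp add: matrix_vector_mult_basis column_def vec_eq_iff)
  have *: "G ** kulkarni_nomizu G P a b = outer (G $ a) (P $ b) - outer (G $ b) (P $ a) +
     (outer (P $ a) (G $ b) - outer (P $ b) (G $ a))" for a b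
    by (simp add: kulkarni_nomizu_def matrix_distribs matrix_mult_outer G' Ga)
  have "transpose (kulkarni_nomizu G P a b) ** G = transpose (G ** kulkarni_nomizu G P a b)" for a b
    by (simp add: matrix_transpose_mul G)
  then have "G ** kulkarni_nomizu G P a b = - (transpose (kulkarni_nomizu G P a b) ** G)" for a b
    by (simp add: * transpose_add transpose_outer)
  moreover have "kulkarni_nomizu G P a b $ d $ c + kulkarni_nomizu G P b c $ d $ a + kulkarni_nomizu G P c a $ d $ b = 0" for a b c d
    using symmetric_matrix_nth[OF G(1)] symmetric_matrix_nth[OF P]
    by (simp add: kulkarni_nomizu_def symmetric_matrix_nth[OF G(1), of b a] symmetric_matrix_nth[OF G(1), of c a]
        symmetric_matrix_nth[OF G(1), of c b] symmetric_matrix_nth[OF P, of b a] symmetric_matrix_nth[OF P, of c a]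
        symmetric_matrix_nth[OF P, of c b])
  ultimately show ?thesis
    by (simp add: curvature_like_def)
qed

text \<open>The first of the four terms contracts to n copies of \<open>P\<close>, the second and
  fourth each remove one copy, and the third gives the trace term.\<close>

lemma kulkarni_nomizu_ricci:
  "(\<Sum>c\<in>UNIV. kulkarni_nomizu G P c a $ c $ b) =
     (real CARD('n) - 2) * P $ a $ b + trace (matrix_inv G ** P) * G $ a $ b"
proof -
  let ?I = "matrix_inv G"
  have 1: "(\<Sum>c\<in>UNIV. axis a (1::real) $ c * P $ c $ b) = P $ a $ b"
    by (simp add: axis_def if_distrib[of "\<lambda>z. z * _"] cong: if_cong)
  have "(\<Sum>c\<in>UNIV. (?I *v P $ c) $ c) = trace (?I ** P)"
    using symmetric_matrix_nth[OF P] by (simp add: trace_def matrix_vector_mult_def matrix_matrix_mult_def)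
  then have 2: "(\<Sum>c\<in>UNIV. (?I *v P $ c) $ c * G $ a $ b) = trace (?I ** P) * G $ a $ b"
    by (simp only: sum_distrib_right[symmetric])
  have "(\<Sum>c\<in>UNIV. (?I *v P $ a) $ c * G $ c $ b) = ((?I *v P $ a) v* G) $ b"
    by (simp add: vector_matrix_mult_def mult.commute)
  also have "(?I *v P $ a) v* G = transpose G *v (?I *v P $ a)"
    by simp
  also have "\<dots> = P $ a"
    using matrix_inv_mult[OF G(2)] G(1) by (simp only: matrix_vector_mul_assoc matrix_vector_mul_lid)
  finally have 3: "(\<Sum>c\<in>UNIV. (?I *v P $ a) $ c * G $ c $ b) = P $ a $ b" .
  show ?thesis
    using 1 2 3 by (simp add: kulkarni_nomizu_def sum.distrib sum_subtractf algebra_simps)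
qed

end

lemma two_form_outer:
  "two_form (\<lambda>a b. outer (X a) (Y b)) u w = outer (\<Sum>a\<in>UNIV. u $ a *\<^sub>R X a) (\<Sum>b\<in>UNIV. w $ b *\<^sub>R Y b)"
  "two_form (\<lambda>a b. outer (X b) (Y a)) u w = outer (\<Sum>b\<in>UNIV. w $ b *\<^sub>R X b) (\<Sum>a\<in>UNIV. u $ a *\<^sub>R Y a)"
proof -
  show 1: "two_form (\<lambda>a b. outer (X a) (Y b)) u w = outer (\<Sum>a\<in>UNIV. u $ a *\<^sub>R X a) (\<Sum>b\<in>UNIV. w $ b *\<^sub>R Y b)"
    for u w by (simp add: vec_eq_iff two_form_nth sum_product mult_ac)
  show "two_form (\<lambda>a b. outer (X b) (Y a)) u w = outer (\<Sum>b\<in>UNIV. w $ b *\<^sub>R X b) (\<Sum>a\<in>UNIV. u $ a *\<^sub>R Y a)"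
    unfolding 1[symmetric] two_form_def by (subst sum.swap) (simp add: mult.commute)
qed

lemma two_form_kulkarni_nomizu:
  fixes G P :: "real^'n^'n"
  shows
  "two_form (kulkarni_nomizu G P) u w = outer u (w v* P) - outer w (u v* P) +
     (outer (matrix_inv G *v (u v* P)) (w v* G) - outer (matrix_inv G *v (w v* P)) (u v* G))"
proof -
  have 1: "(\<Sum>a\<in>UNIV. u $ a *\<^sub>R axis a 1) = u" for u :: "real^'n"
    using basis_expansion[of u] by (simp add: scalar_mult_eq_scaleR)
  have 2: "(\<Sum>a\<in>UNIV. u $ a *\<^sub>R A $ a) = u v* A" for u :: "real^'n" and A :: "real^'n^'n"
    by (simp add: vec_eq_iff vector_matrix_mult_def mult.commute)
  have 3: "(\<Sum>a\<in>UNIV. u $ a *\<^sub>R (A *v P $ a)) = A *v (u v* P)" for u :: "real^'n" and A :: "real^'n^'n"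
    unfolding 2[symmetric] linear_sum[OF matrix_vector_mul_linear] by (simp add: matrix_vector_mult_scaleR)
  have "two_form (kulkarni_nomizu G P) u w =
     two_form (\<lambda>a b. outer (axis a 1) (P $ b)) u w - two_form (\<lambda>a b. outer (axis b 1) (P $ a)) u w +
     (two_form (\<lambda>a b. outer (matrix_inv G *v P $ a) (G $ b)) u w
      - two_form (\<lambda>a b. outer (matrix_inv G *v P $ b) (G $ a)) u w)"
    by (simp add: two_form_def kulkarni_nomizu_def scaleR_right_distrib scaleR_right_diff_distrib
        sum.distrib sum_subtractf)
  then show ?thesis
    by (simp only: two_form_outer 1 2 3)
qed

text \<open>The Kulkarni-Nomizu term consists of exactly the four rank-one terms that the
  telescoping removes. Being curvature-like itself, it leaves a remainder that still satisfies both
  Bianchi identities.\<close>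

lemma alt_trace_weyl:
  assumes G: "transpose G = G" "invertible G" and P: "transpose P = P" and F: "curvature_like G F" and j: "j \<ge> 2"
  shows "alt_trace (replicate j (two_form F)) v =
    alt_trace (replicate j (two_form (\<lambda>a b. F a b - kulkarni_nomizu G P a b))) v"
proof (rule alt_trace_replicate_eq[OF _ _ _ _ _ j])
  have C: "curvature_like G (\<lambda>a b. F a b - kulkarni_nomizu G P a b)"
    by (intro curvature_like_diff F kulkarni_nomizu_curvature_like G P)
  have Gw: "w v* G = G *v w" for w
    using transpose_matrix_vector[of G w] G(1) by simp
  have "two_form F u w = two_form (\<lambda>a b. F a b - kulkarni_nomizu G P a b) u w + two_form (kulkarni_nomizu G P) u w" for u w
    by (simp flip: two_form_add)
  then show "two_form F = (\<lambda>u w. two_form (\<lambda>a b. F a b - kulkarni_nomizu G P a b) u w +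
      (outer u (w v* P) - outer w (u v* P) +
        (outer (matrix_inv G *v (u v* P)) (G *v w) - outer (matrix_inv G *v (w v* P)) (G *v u))))"
    by (simp add: fun_eq_iff two_form_kulkarni_nomizu Gw)
  show "bianchi (two_form F)" "bianchi (two_form (\<lambda>a b. F a b - kulkarni_nomizu G P a b))"
    "cobianchi ((*v) G) (two_form F)" "cobianchi ((*v) G) (two_form (\<lambda>a b. F a b - kulkarni_nomizu G P a b))"
    using F C by (auto intro: curvature_like_bianchi curvature_like_cobianchi)
qed

section \<open>The Levi-Civita connection\<close>

text \<open>For a connection d + A, \<open>D b\<close> sends the constant section
  \<open>axis j 1\<close> to the j-th column of \<open>A b\<close>. The next covariant derivative
  differentiates that column and multiplies it by \<open>A a\<close>.\<close>

lemma curvature_nth: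
  fixes A :: "'n::finite \<Rightarrow> real^'n \<Rightarrow> real^'m::finite^'m"
  assumes D: "\<And>a s x. D a s x = (\<chi> i. partial_deriv a (\<lambda>y. s y $ i) x) + A a x *v s x"
  shows "curvature D a b x $ i $ j =
    partial_deriv a (\<lambda>y. A b y $ i $ j) x - partial_deriv b (\<lambda>y. A a y $ i $ j) x
      + (A a x ** A b x - A b x ** A a x) $ i $ j"
proof -
  have 1: "D b (\<lambda>_. axis j 1) = (\<lambda>y. column j (A b y))" for b
    by (simp add: fun_eq_iff D matrix_vector_mult_basis zero_vec_def[symmetric])
  have "(A a x *v column j (A b x)) $ i = (A a x ** A b x) $ i $ j" for a b
    by (simp add: matrix_vector_mult_def matrix_matrix_mult_def column_def)
  then show ?thesis
    by (simp add: curvature_def matrix_def 1, simp add: D column_def)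
qed

lemma trace_commutator: "trace (A ** B - B ** A) = 0" for A B :: "real^'n::finite^'n"
  by (simp add: trace_sub trace_mul_sym[of A B])

definition christoffel_matrix :: "(real^'n \<Rightarrow> real^'n^'n) \<Rightarrow> 'n::finite \<Rightarrow> real^'n \<Rightarrow> real^'n^'n" where
  "christoffel_matrix g a x = (\<chi> c b. christoffel g c a b x)"

text \<open>The Christoffel symbols of the first kind. They do not involve the inverse metric, so
  their symmetries can be read off linearly.\<close>

definition lowered_christoffel :: "(real^'n \<Rightarrow> real^'n^'n) \<Rightarrow> 'n::finite \<Rightarrow> real^'n \<Rightarrow> real^'n^'n" where
  "lowered_christoffel g a x = (\<chi> d b. 1/2 * (partial_deriv a g x $ d $ b + partial_deriv b g x $ d $ a
     - partial_deriv d g x $ a $ b))"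

definition schouten_matrix :: "(real^'n \<Rightarrow> real^'n^'n) \<Rightarrow> real^'n::finite \<Rightarrow> real^'n^'n" where
  "schouten_matrix g x = (\<chi> a b. schouten g a b x)"

lemma weyl_eq: "weyl g a b x = riemann g a b x - kulkarni_nomizu (g x) (schouten_matrix g x) a b"
  by (auto simp: weyl_def kulkarni_nomizu_def schouten_matrix_def vec_eq_iff matrix_vector_mult_def axis_def)

text \<open>Separates the calculation in coordinates from the manifold. The closure rules of
  \<open>C2_on\<close> make a rescaled metric a second instance.\<close>

locale metric_patch =
  fixes U :: "(real^'n::finite) set" and g :: "real^'n \<Rightarrow> real^'n^'n"
  assumes open_U: "open U" and C2: "C2_on U g"
    and sym: "x \<in> U \<Longrightarrow> transpose (g x) = g x"
    and inv: "x \<in> U \<Longrightarrow> invertible (g x)"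
begin

abbreviation \<Gamma> where "\<Gamma> \<equiv> christoffel_matrix g"
abbreviation R where "R \<equiv> riemann g"

lemma g_sym: "x \<in> U \<Longrightarrow> g x $ a $ b = g x $ b $ a"
  using symmetric_matrix_nth[OF sym] .

lemma deriv_g_nth:
  assumes "x \<in> U"
  shows "partial_deriv c (\<lambda>y. g y $ a $ b) x = partial_deriv c g x $ a $ b"
  using C2_onD(1)[OF C2 assms] by (simp add: partial_deriv_vec_nth differentiable_vec_nth)

lemma deriv_g_sym:
  assumes "x \<in> U"
  shows "partial_deriv c g x $ a $ b = partial_deriv c g x $ b $ a"
  unfolding deriv_g_nth[OF assms, symmetric]
  by (rule partial_deriv_cong[OF open_U assms]) (rule g_sym)

lemma christoffel_matrix_eq:
  assumes "x \<in> U"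
  shows "\<Gamma> a x = matrix_inv (g x) ** lowered_christoffel g a x"
  by (simp add: christoffel_matrix_def lowered_christoffel_def christoffel_def matrix_matrix_mult_def vec_eq_iff
      deriv_g_nth[OF assms] sum_distrib_left mult_ac)

lemma g_christoffel:
  assumes "x \<in> U"
  shows "g x ** \<Gamma> a x = lowered_christoffel g a x"
  using matrix_inv_mult(1)[OF inv[OF assms]] by (simp add: christoffel_matrix_eq[OF assms] matrix_mul_assoc)

lemma differentiable_christoffel:
  assumes x: "x \<in> U"
  shows "\<Gamma> a differentiable at x"
proof -
  have "lowered_christoffel g a differentiable at x"
    unfolding lowered_christoffel_def[abs_def]
    by (intro differentiable_vecI)
      (auto intro!: differentiable_divide differentiable_mult differentiable_add differentiable_diff differentiable_vec_nth C2_onD(2)[OF C2 x])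
  moreover have "(\<lambda>y. matrix_inv (g y)) differentiable at x"
    by (rule differentiable_matrix_inv[OF open_U x C2_onD(1)[OF C2 x] inv])
  ultimately show ?thesis
    by (intro differentiable_cong_open[OF open_U x christoffel_matrix_eq] partial_deriv_matrix_mult)
qed

lemma metric_compatible:
  assumes "x \<in> U"
  shows "partial_deriv a g x = transpose (\<Gamma> a x) ** g x + g x ** \<Gamma> a x"
proof -
  have "transpose (\<Gamma> a x) ** g x = transpose (lowered_christoffel g a x)"
    by (simp add: matrix_transpose_mul sym assms flip: g_christoffel)
  then show ?thesis
    by (simp add: g_christoffel assms lowered_christoffel_def transpose_def vec_eq_iff deriv_g_sym[OF assms] field_simps)
qed

lemma torsion_free:
  assumes "x \<in> U"
  shows "\<Gamma> a x $ c $ b = \<Gamma> b x $ c $ a"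
proof -
  have "lowered_christoffel g a x $ d $ b = lowered_christoffel g b x $ d $ a" for d
    using deriv_g_sym[OF assms] by (simp add: lowered_christoffel_def)
  then show ?thesis
    by (simp add: christoffel_matrix_eq[OF assms] matrix_matrix_mult_def)
qed

lemma deriv_torsion_free:
  assumes "x \<in> U"
  shows "partial_deriv d (\<Gamma> a) x $ c $ b = partial_deriv d (\<Gamma> b) x $ c $ a"
proof -
  note D = differentiable_christoffel[OF assms]
  have "partial_deriv d (\<lambda>y. \<Gamma> a y $ c $ b) x = partial_deriv d (\<lambda>y. \<Gamma> b y $ c $ a) x"
    by (rule partial_deriv_cong[OF open_U assms]) (rule torsion_free)
  then show ?thesis
    by (simp add: partial_deriv_vec_nth differentiable_vec_nth D)
qed

lemma riemann_eq:
  assumes "x \<in> U"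
  shows "R a b x = partial_deriv a (\<Gamma> b) x - partial_deriv b (\<Gamma> a) x + (\<Gamma> a x ** \<Gamma> b x - \<Gamma> b x ** \<Gamma> a x)"
proof -
  have *: "levi_civita g a s x = (\<chi> i. partial_deriv a (\<lambda>y. s y $ i) x) + \<Gamma> a x *v s x" for a s x
    by (simp add: levi_civita_def christoffel_matrix_def vec_eq_iff matrix_vector_mult_def)
  show ?thesis
    using differentiable_christoffel[OF assms]
    by (simp add: vec_eq_iff riemann_def curvature_nth[of "levi_civita g" \<Gamma>, OF *]
        partial_deriv_vec_nth differentiable_vec_nth)
qed

lemma riemann_antisym: "x \<in> U \<Longrightarrow> R a b x = - R b a x"
  by (simp add: riemann_eq)

text \<open>Skewness follows by differentiating metric compatibility once more, since the second
  derivatives of \<open>g\<close> commute. The cyclic identity follows from the symmetry of \<Gamma>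
  and its derivatives in the lower indices.\<close>

lemma riemann_curvature_like:
  assumes x: "x \<in> U"
  shows "curvature_like (g x) (\<lambda>a b. R a b x)"
  unfolding curvature_like_def
proof (intro conjI allI)
  fix a b c d
  note D = differentiable_christoffel[OF x] C2_onD[OF C2 x]
  let ?d = "\<lambda>a b. partial_deriv a (\<Gamma> b) x"
  have dd: "partial_deriv a (partial_deriv b g) x =
      transpose (\<Gamma> b x) ** (transpose (\<Gamma> a x) ** g x + g x ** \<Gamma> a x) + transpose (?d a b) ** g x +
      (g x ** ?d a b + (transpose (\<Gamma> a x) ** g x + g x ** \<Gamma> a x) ** \<Gamma> b x)" for a b
  proof -
    have "partial_deriv a (partial_deriv b g) x = partial_deriv a (\<lambda>y. transpose (\<Gamma> b y) ** g y + g y ** \<Gamma> b y) x"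
      by (rule partial_deriv_cong[OF open_U x]) (rule metric_compatible)
    moreover have t: "(\<lambda>y. transpose (\<Gamma> b y)) differentiable at x"
      by (intro differentiable_transpose D)
    ultimately show ?thesis
      by (simp add: partial_deriv_add partial_deriv_matrix_mult D(1,2) t partial_deriv_transpose metric_compatible x)
  qed
  note dd[of a b, symmetric]
  also note D(4)[of a b]
  also note dd[of b a]
  finally have E: "transpose (\<Gamma> b x) ** (transpose (\<Gamma> a x) ** g x + g x ** \<Gamma> a x) + transpose (?d a b) ** g x +
      (g x ** ?d a b + (transpose (\<Gamma> a x) ** g x + g x ** \<Gamma> a x) ** \<Gamma> b x) =
      transpose (\<Gamma> a x) ** (transpose (\<Gamma> b x) ** g x + g x ** \<Gamma> b x) + transpose (?d b a) ** g x +
      (g x ** ?d b a + (transpose (\<Gamma> b x) ** g x + g x ** \<Gamma> b x) ** \<Gamma> a x)" .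
  show "g x ** R a b x = - (transpose (R a b x) ** g x)"
    unfolding vec_eq_iff
  proof (intro allI)
    fix i j
    show "(g x ** R a b x) $ i $ j = (- (transpose (R a b x) ** g x)) $ i $ j"
      using arg_cong[OF E, of "\<lambda>M. M $ i $ j"]
      unfolding riemann_eq[OF x] matrix_distribs matrix_mul_assoc
        vector_add_component vector_minus_component vector_uminus_component
      by linarith
  qed
  have *: "(\<Gamma> a x ** \<Gamma> b x) $ d $ c = (\<Gamma> a x ** \<Gamma> c x) $ d $ b" for a b c
    using torsion_free[OF x, of b _ c] by (simp add: matrix_matrix_mult_def)
  show "R a b x $ d $ c + R b c x $ d $ a + R c a x $ d $ b = 0"
    using deriv_torsion_free[OF x, of a b d c] deriv_torsion_free[OF x, of b c d a] deriv_torsion_free[OF x, of c a d b]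
      *[of a b c] *[of b c a] *[of c a b] by (simp add: riemann_eq[OF x])
qed

text \<open>By skewness \<open>R a b x\<close> is conjugate to minus its transpose. The vanishing
  trace makes the Ricci tensor symmetric and the density bundles flat.\<close>

lemma trace_riemann:
  assumes x: "x \<in> U"
  shows "trace (R a b x) = 0"
proof -
  let ?I = "matrix_inv (g x)"
  have "R a b x = ?I ** (g x ** R a b x)"
    by (simp add: matrix_mul_assoc matrix_inv_mult inv x)
  also have "\<dots> = - (?I ** (transpose (R a b x) ** g x))"
    using riemann_curvature_like[OF x] by (simp add: curvature_like_def matrix_diff_mult)
  finally have "trace (R a b x) = - trace (?I ** (transpose (R a b x) ** g x))"
    by (metis trace_scaleR scaleR_minus1_left mult_minus1)
  also have "trace (?I ** (transpose (R a b x) ** g x)) = trace (transpose (R a b x) ** g x ** ?I)"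
    by (rule trace_mul_sym)
  also have "\<dots> = trace (transpose (R a b x) ** (g x ** ?I))"
    by (simp only: matrix_mul_assoc)
  finally show ?thesis
    by (simp add: matrix_inv_mult inv x trace_transpose)
qed

lemma ricci_sym:
  assumes x: "x \<in> U"
  shows "ricci g a b x = ricci g b a x"
proof -
  have "R c a x $ c $ b + R a b x $ c $ c + R b c x $ c $ a = 0" for c
    using riemann_curvature_like[OF x] by (simp add: curvature_like_def)
  then have "R c a x $ c $ b + R a b x $ c $ c - R c b x $ c $ a = 0" for c
    by (metis riemann_antisym[OF x] vector_uminus_component add_uminus_conv_diff)
  then have "(\<Sum>c\<in>UNIV. R c a x $ c $ b + R a b x $ c $ c - R c b x $ c $ a) = 0"
    by simp
  then show ?thesis
    using trace_riemann[OF x, of a b] by (simp add: ricci_def sum.distrib sum_subtractf trace_def)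
qed

lemma schouten_sym:
  assumes x: "x \<in> U"
  shows "schouten g a b x = schouten g b a x"
  by (simp add: schouten_def ricci_sym[OF x, of a] g_sym[OF x, of a])

lemma transpose_schouten: "x \<in> U \<Longrightarrow> transpose (schouten_matrix g x) = schouten_matrix g x"
  by (simp add: schouten_matrix_def transpose_def vec_eq_iff schouten_sym)

lemma weyl_curvature_like:
  assumes x: "x \<in> U"
  shows "curvature_like (g x) (\<lambda>a b. weyl g a b x)"
  unfolding weyl_eq
  by (intro curvature_like_diff riemann_curvature_like kulkarni_nomizu_curvature_like transpose_schouten sym inv x)

end

section \<open>The tractor curvature\<close>

text \<open>The zeroth-order part of the tractor connection, in the form that
  \<open>curvature_nth\<close> expects. The last diagonal entry uses that the weight -1 coefficient
  is minus the weight 1 coefficient.\<close>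

definition tractor_matrix ::
    "(real^'n \<Rightarrow> real^'n^'n) \<Rightarrow> 'n::finite \<Rightarrow> real^'n \<Rightarrow> real^('n tractor_index)^('n tractor_index)" where
  "tractor_matrix g a x = (\<chi> i j. case i of
       Inl _ \<Rightarrow> (case j of Inl _ \<Rightarrow> density_coeff g 1 a x
         | Inr (Inl c) \<Rightarrow> if c = a then - 1 else 0
         | Inr (Inr _) \<Rightarrow> 0)
     | Inr (Inl b) \<Rightarrow> (case j of Inl _ \<Rightarrow> schouten g a b x
         | Inr (Inl c) \<Rightarrow> (if c = b then density_coeff g 1 a x else 0) - christoffel g c a b x
         | Inr (Inr _) \<Rightarrow> conformal_metric g x $ a $ b)
     | Inr (Inr _) \<Rightarrow> (case j of Inl _ \<Rightarrow> 0
         | Inr (Inl c) \<Rightarrow> - (\<Sum>b\<in>UNIV. schouten g a b x * matrix_inv (conformal_metric g x) $ b $ c)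
         | Inr (Inr _) \<Rightarrow> - density_coeff g 1 a x))"

lemma density_coeff_minus: "density_coeff g (- w) a x = - density_coeff g w a x"
  by (simp add: density_coeff_def)

lemma tractor_connection_eq:
  "tractor_connection g a s x = (\<chi> i. partial_deriv a (\<lambda>y. s y $ i) x) + tractor_matrix g a x *v s x"
proof -
  have "(\<Sum>b\<in>UNIV. schouten g a b x * (\<Sum>c\<in>UNIV. matrix_inv (conformal_metric g x) $ b $ c * \<mu> c)) =
      (\<Sum>c\<in>UNIV. (\<Sum>b\<in>UNIV. schouten g a b x * matrix_inv (conformal_metric g x) $ b $ c) * \<mu> c)" for \<mu>
    by (simp add: sum_distrib_left sum_distrib_right mult.assoc) (rule sum.swap)
  then show ?thesis
    by (auto simp: vec_eq_iff tractor_connection_def Let_def tractor_matrix_def matrix_vector_mult_def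
        sum_tractor_index density_coeff_minus left_diff_distrib sum_subtractf mult_delta_left sum_negf
        split: sum.split)
qed

lemma bounded_linear_trace: "bounded_linear (trace :: real^'n::finite^'n \<Rightarrow> real)"
  by (auto intro!: linearI simp: linear_conv_bounded_linear[symmetric] trace_add trace_scaleR)

context metric_patch
begin

lemma trace_christoffel:
  assumes "x \<in> U"
  shows "(\<Sum>c\<in>UNIV. christoffel g c c a x) = trace (\<Gamma> a x)"
proof -
  have "christoffel g c c a x = \<Gamma> a x $ c $ c" for c
    using torsion_free[OF assms, of c c a] by (simp add: christoffel_matrix_def)
  then show ?thesis by (simp add: trace_def)
qed

lemma density_coeff_eq: "x \<in> U \<Longrightarrow> density_coeff g w a x = w / real CARD('n) * trace (\<Gamma> a x)"
  by (simp add: density_coeff_def trace_christoffel)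

lemma deriv_density:
  assumes x: "x \<in> U"
  shows "density_coeff g w a differentiable at x"
    and "partial_deriv b (density_coeff g w a) x = w / real CARD('n) * trace (partial_deriv b (\<Gamma> a) x)"
proof -
  have L: "bounded_linear (\<lambda>A :: real^'n^'n. w / real CARD('n) * trace A)"
    by (intro bounded_linear_const_mult bounded_linear_trace)
  note D = differentiable_christoffel[OF x]
  show "density_coeff g w a differentiable at x"
    by (rule differentiable_cong_open[OF open_U x density_coeff_eq differentiable_bounded_linear[OF L D]])
  have "partial_deriv b (density_coeff g w a) x = partial_deriv b (\<lambda>x. w / real CARD('n) * trace (\<Gamma> a x)) x"
    by (rule partial_deriv_cong[OF open_U x]) (rule density_coeff_eq)
  then show "partial_deriv b (density_coeff g w a) x = w / real CARD('n) * trace (partial_deriv b (\<Gamma> a) x)"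
    by (simp only: partial_deriv_bounded_linear[OF L D])
qed

text \<open>Commutators have trace zero, so the curvature of a density bundle is a multiple of the
  trace of the Riemann tensor.\<close>

lemma density_flat:
  assumes x: "x \<in> U"
  shows "partial_deriv a (density_coeff g w b) x = partial_deriv b (density_coeff g w a) x"
proof -
  have "trace (partial_deriv a (\<Gamma> b) x) - trace (partial_deriv b (\<Gamma> a) x) = trace (R a b x)"
    unfolding riemann_eq[OF x] trace_add trace_commutator by (simp add: trace_sub)
  then show ?thesis
    using trace_riemann[OF x] by (simp add: deriv_density[OF x])
qed

abbreviation cg where "cg \<equiv> conformal_metric g"

text \<open>The conformal metric is parallel as a tensor of weight 2. The density term comes from
  Jacobi's formula, because the trace of the inverse metric times the derivative of \<open>g\<close>
  is twice the trace of \<Gamma>.\<close>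

lemma deriv_conformal_metric:
  assumes x: "x \<in> U"
  shows "cg differentiable at x"
    and "partial_deriv a cg x = (- 2 * density_coeff g 1 a x) *\<^sub>R cg x + (transpose (\<Gamma> a x) ** cg x + cg x ** \<Gamma> a x)"
proof -
  let ?q = "- 1 / real CARD('n)" and ?I = "matrix_inv (g x)"
  note D = C2_onD(1)[OF C2 x] inv[OF x]
  have "trace (?I ** (transpose (\<Gamma> a x) ** g x)) = trace (transpose (\<Gamma> a x) ** g x ** ?I)"
    by (rule trace_mul_sym)
  also have "\<dots> = trace (\<Gamma> a x)"
    by (simp add: matrix_mul_assoc[symmetric] matrix_inv_mult D trace_transpose)
  finally have 1: "trace (?I ** partial_deriv a g x) = 2 * trace (\<Gamma> a x)"
    by (simp add: metric_compatible[OF x] matrix_add_ldistrib trace_add matrix_mul_assoc matrix_inv_mult D)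
  have det: "det (g x) \<noteq> 0"
    using D by (simp add: invertible_det_nz)
  note powr = partial_deriv_abs_powr[OF partial_deriv_det(1)[OF D] det]
  show "cg differentiable at x"
    unfolding conformal_metric_def[abs_def] by (intro partial_deriv_scaleR powr D)
  have "partial_deriv a cg x = \<bar>det (g x)\<bar> powr ?q *\<^sub>R partial_deriv a g x +
      (?q * \<bar>det (g x)\<bar> powr ?q / det (g x) * (det (g x) * (2 * trace (\<Gamma> a x)))) *\<^sub>R g x"
    unfolding conformal_metric_def[abs_def]
    by (simp only: partial_deriv_scaleR(2)[OF powr(1) D(1)] powr(2) partial_deriv_det(2)[OF D] 1)
  then show "partial_deriv a cg x = (- 2 * density_coeff g 1 a x) *\<^sub>R cg x + (transpose (\<Gamma> a x) ** cg x + cg x ** \<Gamma> a x)"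
    using det by (simp add: metric_compatible[OF x] density_coeff_eq[OF x] conformal_metric_def scaleR_right_distrib
        scaleR_matrix_mult_left scaleR_matrix_mult_right)
qed

lemma cg_sym: "x \<in> U \<Longrightarrow> cg x $ a $ b = cg x $ b $ a"
  by (simp add: conformal_metric_def g_sym[of x a])

lemma cg_invertible: "x \<in> U \<Longrightarrow> \<bar>det (g x)\<bar> powr (- 1 / real CARD('n)) \<noteq> 0"
  using inv[of x] by (simp add: invertible_det_nz)

lemma matrix_inv_cg:
  assumes "x \<in> U"
  shows "matrix_inv (cg x) = (1 / \<bar>det (g x)\<bar> powr (- 1 / real CARD('n))) *\<^sub>R matrix_inv (g x)"
  unfolding conformal_metric_def by (rule matrix_inv_scaleR[OF inv[OF assms] cg_invertible[OF assms]])

text \<open>The density factors of the conformal metric and of its inverse cancel, which leaves the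
  indices raised and lowered by \<open>g\<close> itself.\<close>

lemma schouten_raise:
  assumes x: "x \<in> U"
  shows "(\<Sum>d\<in>UNIV. schouten g b d x * matrix_inv (cg x) $ d $ e) * cg x $ a $ c
    = (matrix_inv (g x) *v schouten_matrix g x $ b) $ e * g x $ a $ c"
proof -
  have "matrix_inv (g x) $ d $ e = matrix_inv (g x) $ e $ d" for d
    using matrix_inv_transpose[OF inv[OF x] sym[OF x]] by (rule symmetric_matrix_nth)
  then show ?thesis
    using cg_invertible[OF x]
    unfolding matrix_inv_cg[OF x]
    by (simp add: conformal_metric_def matrix_vector_mult_def schouten_matrix_def
        sum_divide_distrib[symmetric] mult.commute)
qed

lemma schouten_raise_lower:
  assumes x: "x \<in> U"
  shows "(\<Sum>c\<in>UNIV. (\<Sum>d\<in>UNIV. schouten g a d x * matrix_inv (cg x) $ d $ c) * cg x $ b $ c) = schouten g a b x"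
proof -
  have "(\<Sum>c\<in>UNIV. (\<Sum>d\<in>UNIV. schouten g a d x * matrix_inv (cg x) $ d $ c) * cg x $ b $ c)
    = (g x *v (matrix_inv (g x) *v schouten_matrix g x $ a)) $ b"
    unfolding schouten_raise[OF x] matrix_vector_mult_def[of "g x"] by (simp add: mult.commute)
  also have "\<dots> = schouten g a b x"
    by (simp add: matrix_vector_mul_assoc matrix_inv_mult inv x schouten_matrix_def)
  finally show ?thesis .
qed

lemma tractor_curvature_nth:
  "tractor_curvature g a b x $ i $ j =
    partial_deriv a (\<lambda>y. tractor_matrix g b y $ i $ j) x - partial_deriv b (\<lambda>y. tractor_matrix g a y $ i $ j) x
      + ((\<Sum>k\<in>UNIV. tractor_matrix g a x $ i $ k * tractor_matrix g b x $ k $ j)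
        - (\<Sum>k\<in>UNIV. tractor_matrix g b x $ i $ k * tractor_matrix g a x $ k $ j))"
  using curvature_nth[of "tractor_connection g" "tractor_matrix g", OF tractor_connection_eq]
  by (simp add: tractor_curvature_def matrix_matrix_mult_def)

lemma christoffel_sym: "x \<in> U \<Longrightarrow> christoffel g c a b x = christoffel g c b a x"
  using torsion_free[of x a c b] by (simp add: christoffel_matrix_def)

text \<open>The two corner entries on the diagonal vanish since densities are flat and the Schouten
  tensor is symmetric; sigma-mu because the connection is torsion-free, sigma-rho by symmetry of the
  metric, and mu-rho because the conformal metric is parallel.\<close>

lemma tractor_curvature_outer:
  assumes x: "x \<in> U"
  shows "strict_outer_blocks (tractor_curvature g a b x)"
proof -
  let ?F = "tractor_curvature g a b x" and ?d = "\<lambda>a. density_coeff g 1 a x"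
  note simps = tractor_curvature_nth sum_tractor_index tractor_matrix_def mult_delta_left mult_delta_right
  have "?F $ Inl () $ Inl () = 0"
    by (simp add: simps density_flat[OF x, of a 1 b] schouten_sym[OF x, of a b])
  moreover have "?F $ Inl () $ Inr (Inl c) = 0" for c
    by (simp add: simps christoffel_sym[OF x, of c a b])
  moreover have "?F $ Inl () $ Inr (Inr ()) = 0"
    by (simp add: simps cg_sym[OF x, of a b])
  moreover have "?F $ Inr (Inl c) $ Inr (Inr ()) = 0" for c
  proof -
    have "partial_deriv a (\<lambda>y. cg y $ b $ c) x = - 2 * ?d a * cg x $ b $ c
        + ((\<Sum>d\<in>UNIV. christoffel g d a b x * cg x $ d $ c) + (\<Sum>d\<in>UNIV. christoffel g d a c x * cg x $ b $ d))" for a b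
      using deriv_conformal_metric(2)[OF x, of a] deriv_conformal_metric(1)[OF x]
      by (simp add: partial_deriv_vec_nth differentiable_vec_nth matrix_matrix_mult_def transpose_def
          christoffel_matrix_def mult.commute)
    then show ?thesis
      using christoffel_sym[OF x, of _ a b]
      by (simp add: simps left_diff_distrib sum_subtractf)
  qed
  moreover have "?F $ Inr (Inr ()) $ Inr (Inr ()) = 0"
  proof -
    show ?thesis
      by (simp add: simps partial_deriv_minus deriv_density(1)[OF x] density_flat[OF x, of a 1 b] sum_negf
          schouten_raise_lower[OF x] schouten_sym[OF x, of a b])
  qed
  ultimately show ?thesis
    by (simp add: strict_outer_blocks_def split_sum_all)
qed

text \<open>The connection on covectors contributes minus the transposed Riemann tensor. Paths
  through the sigma and rho slots pair the Schouten tensor with the identity and with the metric,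
  which is the Kulkarni-Nomizu term.\<close>

lemma tractor_curvature_middle:
  assumes x: "x \<in> U"
  shows "middle_block (tractor_curvature g a b x) = - transpose (weyl g a b x)"
proof -
  let ?P = "schouten_matrix g x" and ?I = "matrix_inv (g x)"
  have D: "partial_deriv a (\<lambda>y. (if e = c then density_coeff g 1 b y else 0) - christoffel g e b c y) x =
      (if e = c then partial_deriv a (density_coeff g 1 b) x else 0) - partial_deriv a (\<Gamma> b) x $ e $ c" for a b c e
  proof -
    have 1: "christoffel g e b c = (\<lambda>y. \<Gamma> b y $ e $ c)"
      by (simp add: christoffel_matrix_def)
    show ?thesis
      unfolding 1 using deriv_density[OF x] differentiable_christoffel[OF x]
      by (cases "e = c") (simp_all add: partial_deriv_diff partial_deriv_minus partial_deriv_vec_nth differentiable_vec_nth)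
  qed
  have "tractor_curvature g a b x $ Inr (Inl c) $ Inr (Inl e) = - weyl g a b x $ e $ c" for c e
  proof -
    have "tractor_curvature g a b x $ Inr (Inl c) $ Inr (Inl e) =
       - (partial_deriv a (\<Gamma> b) x $ e $ c - partial_deriv b (\<Gamma> a) x $ e $ c
         + ((\<Sum>d\<in>UNIV. \<Gamma> a x $ e $ d * \<Gamma> b x $ d $ c) - (\<Sum>d\<in>UNIV. \<Gamma> b x $ e $ d * \<Gamma> a x $ d $ c))
         - ((if e = a then ?P $ b $ c else 0) - (if e = b then ?P $ a $ c else 0)
            + (?I *v ?P $ a) $ e * g x $ b $ c - (?I *v ?P $ b) $ e * g x $ a $ c))"
      unfolding schouten_raise[OF x, symmetric]
      using density_flat[OF x, of a 1 b]
      by (simp add: tractor_curvature_nth sum_tractor_index tractor_matrix_def D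
          mult_delta_left mult_delta_right left_diff_distrib right_diff_distrib sum_subtractf
          schouten_matrix_def christoffel_matrix_def mult.commute) auto
    then show ?thesis
      by (simp add: weyl_eq kulkarni_nomizu_def riemann_eq[OF x] matrix_matrix_mult_def axis_def)
  qed
  then show ?thesis
    by (simp add: middle_block_def transpose_def vec_eq_iff)
qed

end

section \<open>Conformal change of the metric\<close>

lemma kulkarni_nomizu_diff:
  "kulkarni_nomizu G (P - Q) a b = kulkarni_nomizu G P a b - kulkarni_nomizu G Q a b"
  by (simp add: kulkarni_nomizu_def outer_diff_left outer_diff_right algebra_simps)

lemma kulkarni_nomizu_scaleR:
  assumes "invertible G" "r \<noteq> 0"
  shows "kulkarni_nomizu (r *\<^sub>R G) P a b = kulkarni_nomizu G P a b"
  using assms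
  by (simp add: kulkarni_nomizu_def matrix_inv_scaleR outer_scaleR_left outer_scaleR_right scaleR_matrix_vector_assoc[symmetric])

locale conformal_patch = metric_patch U g for U :: "(real^'n::finite) set" and g +
  fixes w :: "real^'n \<Rightarrow> real" and h :: "real^'n \<Rightarrow> real^'n^'n"
  assumes C2_w: "C2_on U w" and h_eq: "x \<in> U \<Longrightarrow> h x = exp (2 * w x) *\<^sub>R g x"
begin

lemma metric_patch_h: "metric_patch U h"
proof
  show "C2_on U h"
    by (rule C2_on_cong[OF open_U C2_on_scaleR[OF open_U C2_on_exp[OF open_U C2_w] C2] h_eq])
  show "transpose (h x) = h x" "invertible (h x)" if "x \<in> U" for x
    using that sym inv by (simp_all add: h_eq transpose_scalar scalar_invertible)
qed (rule open_U)

sublocale h: metric_patch U h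
  by (rule metric_patch_h)

definition \<Upsilon> where "\<Upsilon> x = (\<chi> a. partial_deriv a w x)"
definition \<Upsilon>_up where "\<Upsilon>_up x = matrix_inv (g x) *v \<Upsilon> x"
text \<open>The difference of the two Levi-Civita connections along the a-th coordinate field; row
  c, column b holds Upsilon_a delta^c_b + delta^c_a Upsilon_b - Upsilon^c g_ab.\<close>

definition \<Sigma> where "\<Sigma> a x = \<Upsilon> x $ a *\<^sub>R mat 1 + outer (axis a 1) (\<Upsilon> x) - outer (\<Upsilon>_up x) (g x $ a)"

lemma inv_g_row:
  assumes "x \<in> U"
  shows "matrix_inv (g x) *v g x $ a = axis a 1"
proof -
  have "g x $ a = g x *v axis a 1"
    by (simp add: matrix_vector_mult_basis column_def vec_eq_iff g_sym[OF assms, of a])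
  then show ?thesis
    by (simp add: matrix_vector_mul_assoc matrix_inv_mult inv assms)
qed

lemma g_\<Upsilon>_up: "x \<in> U \<Longrightarrow> g x *v \<Upsilon>_up x = \<Upsilon> x"
  by (simp add: \<Upsilon>_up_def matrix_vector_mul_assoc matrix_inv_mult inv)

lemma christoffel_h:
  assumes x: "x \<in> U"
  shows "christoffel_matrix h a x = \<Gamma> a x + \<Sigma> a x"
proof -
  let ?f = "exp (2 * w x)"
  note D = C2_onD(1)[OF C2_w x] C2_onD(1)[OF C2 x]
  have "partial_deriv a h x = ?f *\<^sub>R partial_deriv a g x + (?f * (2 * \<Upsilon> x $ a)) *\<^sub>R g x" for a
  proof -
    have "partial_deriv a h x = partial_deriv a (\<lambda>y. exp (2 * w y) *\<^sub>R g y) x"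
      by (rule partial_deriv_cong[OF open_U x h_eq])
    then show ?thesis
      by (simp add: partial_deriv_scaleR partial_deriv_exp D \<Upsilon>_def)
  qed
  then have "lowered_christoffel h a x = ?f *\<^sub>R (lowered_christoffel g a x + (\<Upsilon> x $ a *\<^sub>R g x +
      outer (g x $ a) (\<Upsilon> x) - outer (\<Upsilon> x) (g x $ a)))"
    using g_sym[OF x, of a]
    by (simp add: lowered_christoffel_def vec_eq_iff) (simp add: algebra_simps add_divide_distrib diff_divide_distrib)
  then have "christoffel_matrix h a x = matrix_inv (g x) ** (lowered_christoffel g a x + (\<Upsilon> x $ a *\<^sub>R g x +
      outer (g x $ a) (\<Upsilon> x) - outer (\<Upsilon> x) (g x $ a)))"
    by (simp add: h.christoffel_matrix_eq[OF x] h_eq[OF x] matrix_inv_scaleR inv[OF x]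
        scaleR_matrix_mult_left scaleR_matrix_mult_right)
  then show ?thesis
    by (simp add: christoffel_matrix_eq[OF x] \<Sigma>_def matrix_distribs scaleR_matrix_mult_left matrix_mult_outer
        matrix_inv_mult inv_g_row inv x \<Upsilon>_up_def)
qed

text \<open>The covariant derivative of the 1-form \<Upsilon> for the connection of
  \<open>g\<close>.\<close>

definition D\<Upsilon> where "D\<Upsilon> a x = partial_deriv a \<Upsilon> x - \<Upsilon> x v* \<Gamma> a x"

text \<open>The amount by which the Schouten tensor of \<open>g\<close> exceeds that of
  \<open>h\<close>, as \<open>schouten_h\<close> confirms.\<close>

definition \<Xi> where "\<Xi> x = (\<chi> a. D\<Upsilon> a x - \<Upsilon> x $ a *\<^sub>R \<Upsilon> x + ((\<Upsilon> x \<bullet> \<Upsilon>_up x) / 2) *\<^sub>R g x $ a)"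

lemma differentiable_\<Upsilon>: "x \<in> U \<Longrightarrow> \<Upsilon> differentiable at x"
  unfolding \<Upsilon>_def[abs_def] by (rule differentiable_vecI) (simp add: C2_onD(2)[OF C2_w])

lemma deriv_\<Upsilon>_sym:
  assumes "x \<in> U"
  shows "partial_deriv a \<Upsilon> x $ b = partial_deriv b \<Upsilon> x $ a"
  using C2_onD(3)[OF C2_w assms, of a b]
  by (simp add: partial_deriv_vec_nth[OF differentiable_\<Upsilon>[OF assms], symmetric]) (simp add: \<Upsilon>_def)

lemma deriv_\<Upsilon>_up:
  assumes x: "x \<in> U"
  shows "\<Upsilon>_up differentiable at x"
    and "partial_deriv a \<Upsilon>_up x = matrix_inv (g x) *v D\<Upsilon> a x - \<Gamma> a x *v \<Upsilon>_up x"
proof -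
  note D = C2_onD(1)[OF C2 x] differentiable_\<Upsilon>[OF x]
  show d: "\<Upsilon>_up differentiable at x"
    unfolding \<Upsilon>_up_def[abs_def]
    by (intro partial_deriv_matrix_vector D differentiable_matrix_inv[OF open_U x] inv)
  \<comment> \<open>Differentiating the lowered relation and solving for the derivative avoids a
    formula for the derivative of the inverse metric.\<close>
  have "partial_deriv a \<Upsilon> x = partial_deriv a (\<lambda>y. g y *v \<Upsilon>_up y) x"
    by (rule partial_deriv_cong[OF open_U x]) (simp add: g_\<Upsilon>_up)
  also have "\<dots> = g x *v partial_deriv a \<Upsilon>_up x + partial_deriv a g x *v \<Upsilon>_up x"
    by (rule partial_deriv_matrix_vector[OF D(1) d])
  also have "partial_deriv a g x *v \<Upsilon>_up x = \<Upsilon> x v* \<Gamma> a x + g x *v (\<Gamma> a x *v \<Upsilon>_up x)"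
    by (simp add: metric_compatible[OF x] matrix_vector_mult_add_rdistrib g_\<Upsilon>_up[OF x] flip: matrix_vector_mul_assoc)
  finally have "g x *v partial_deriv a \<Upsilon>_up x = D\<Upsilon> a x - g x *v (\<Gamma> a x *v \<Upsilon>_up x)"
    by (simp add: D\<Upsilon>_def algebra_simps)
  then have "matrix_inv (g x) *v (g x *v partial_deriv a \<Upsilon>_up x) =
      matrix_inv (g x) *v (D\<Upsilon> a x - g x *v (\<Gamma> a x *v \<Upsilon>_up x))"
    by simp
  then show "partial_deriv a \<Upsilon>_up x = matrix_inv (g x) *v D\<Upsilon> a x - \<Gamma> a x *v \<Upsilon>_up x"
    by (simp add: matrix_vector_mult_diff_distrib matrix_vector_mul_assoc matrix_mul_assoc matrix_inv_mult inv x)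
qed

lemma deriv_\<Sigma>:
  assumes x: "x \<in> U"
  shows "\<Sigma> b differentiable at x"
    and "partial_deriv a (\<Sigma> b) x = partial_deriv a \<Upsilon> x $ b *\<^sub>R mat 1 + outer (axis b 1) (partial_deriv a \<Upsilon> x)
     - (outer (\<Upsilon>_up x) (partial_deriv a g x $ b) + outer (partial_deriv a \<Upsilon>_up x) (g x $ b))"
proof -
  note D = C2_onD(1)[OF C2 x] differentiable_\<Upsilon>[OF x] deriv_\<Upsilon>_up(1)[OF x]
  have 1: "(\<lambda>y. \<Upsilon> y $ b *\<^sub>R (mat 1 :: real^'n^'n)) differentiable at x"
    "partial_deriv a (\<lambda>y. \<Upsilon> y $ b *\<^sub>R (mat 1 :: real^'n^'n)) x = partial_deriv a \<Upsilon> x $ b *\<^sub>R mat 1"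
    by (simp_all add: partial_deriv_scaleR D differentiable_vec_nth partial_deriv_vec_nth)
  have 2: "(\<lambda>y. outer (axis b 1 :: real^'n) (\<Upsilon> y)) differentiable at x"
    "partial_deriv a (\<lambda>y. outer (axis b 1 :: real^'n) (\<Upsilon> y)) x = outer (axis b 1) (partial_deriv a \<Upsilon> x)"
    by (simp_all add: partial_deriv_outer D)
  have 3: "(\<lambda>y. outer (\<Upsilon>_up y) (g y $ b)) differentiable at x"
    "partial_deriv a (\<lambda>y. outer (\<Upsilon>_up y) (g y $ b)) x =
      outer (\<Upsilon>_up x) (partial_deriv a g x $ b) + outer (partial_deriv a \<Upsilon>_up x) (g x $ b)"
    by (simp_all add: partial_deriv_outer D differentiable_vec_nth partial_deriv_vec_nth)
  show "\<Sigma> b differentiable at x"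
    unfolding \<Sigma>_def[abs_def] by (intro differentiable_diff differentiable_add 1 2 3)
  show "partial_deriv a (\<Sigma> b) x = partial_deriv a \<Upsilon> x $ b *\<^sub>R mat 1 + outer (axis b 1) (partial_deriv a \<Upsilon> x)
     - (outer (\<Upsilon>_up x) (partial_deriv a g x $ b) + outer (partial_deriv a \<Upsilon>_up x) (g x $ b))"
    unfolding \<Sigma>_def[abs_def]
    by (simp add: partial_deriv_diff partial_deriv_add differentiable_add 1 2 3)
qed

text \<open>\<Upsilon> is closed, being the differential of \<open>w\<close>, and the connection is
  torsion-free, so its covariant derivative is symmetric.\<close>

lemma \<Xi>_sym:
  assumes x: "x \<in> U"
  shows "transpose (\<Xi> x) = \<Xi> x"
proof -
  have "(\<Upsilon> x v* \<Gamma> a x) $ b = (\<Upsilon> x v* \<Gamma> b x) $ a" for a b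
    by (simp add: vector_matrix_mult_def torsion_free[OF x, of a _ b])
  then have "D\<Upsilon> a x $ b = D\<Upsilon> b x $ a" for a b
    by (simp add: D\<Upsilon>_def deriv_\<Upsilon>_sym[OF x, of a b])
  then show ?thesis
    by (simp add: \<Xi>_def transpose_def vec_eq_iff g_sym[OF x] mult.commute)
qed

text \<open>Only the endomorphism indices are differentiated covariantly. The terms with a bare
  column of \<Gamma>, and the multiple of the identity, are symmetric in \<open>a\<close> and
  \<open>b\<close> and drop out of the curvature.\<close>

lemma covariant_deriv_\<Sigma>:
  assumes x: "x \<in> U"
  shows "partial_deriv a (\<Sigma> b) x + (\<Gamma> a x ** \<Sigma> b x - \<Sigma> b x ** \<Gamma> a x) =
    partial_deriv a \<Upsilon> x $ b *\<^sub>R mat 1 + outer (axis b 1) (D\<Upsilon> a x)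
     - outer (\<Upsilon>_up x) (g x *v column b (\<Gamma> a x)) - outer (matrix_inv (g x) *v D\<Upsilon> a x) (g x $ b)
     + outer (column b (\<Gamma> a x)) (\<Upsilon> x)"
proof -
  have "partial_deriv a g x $ b = g x *v column b (\<Gamma> a x) + g x $ b v* \<Gamma> a x"
    by (simp add: metric_compatible[OF x] vec_eq_iff matrix_matrix_mult_def transpose_def matrix_vector_mult_def
        vector_matrix_mult_def column_def g_sym[OF x] mult.commute)
  then show ?thesis
    unfolding deriv_\<Sigma>(2)[OF x] deriv_\<Upsilon>_up(2)[OF x]
    by (simp add: \<Sigma>_def D\<Upsilon>_def matrix_distribs matrix_mult_outer outer_mult_matrix scaleR_matrix_mult_left
        scaleR_matrix_mult_right matrix_vector_mult_basis outer_add_left outer_add_right outer_diff_left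
        outer_diff_right algebra_simps)
qed

lemma commutator_\<Sigma>:
  assumes x: "x \<in> U"
  shows "\<Sigma> a x ** \<Sigma> b x - \<Sigma> b x ** \<Sigma> a x =
    \<Upsilon> x $ b *\<^sub>R outer (axis a 1) (\<Upsilon> x) - \<Upsilon> x $ a *\<^sub>R outer (axis b 1) (\<Upsilon> x)
     - (\<Upsilon> x \<bullet> \<Upsilon>_up x) *\<^sub>R (outer (axis a 1) (g x $ b) - outer (axis b 1) (g x $ a))
     + (\<Upsilon> x $ a *\<^sub>R outer (\<Upsilon>_up x) (g x $ b) - \<Upsilon> x $ b *\<^sub>R outer (\<Upsilon>_up x) (g x $ a))"
proof -
  have "g x $ a \<bullet> \<Upsilon>_up x = \<Upsilon> x $ a" for a
    using arg_cong[OF g_\<Upsilon>_up[OF x], of "\<lambda>v. v $ a"] by (simp add: matrix_vector_mul_component)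
  moreover have "u \<bullet> axis a 1 = u $ a" for u :: "real^'n" and a
    by (simp add: inner_axis)
  ultimately show ?thesis
    by (simp add: \<Sigma>_def matrix_distribs outer_mult_outer scaleR_matrix_mult_left scaleR_matrix_mult_right
        scaleR_right_diff_distrib scaleR_right_distrib g_sym[OF x, of a b] algebra_simps)
qed

text \<open>The curvature of \<Gamma> + \<Sigma> gains the antisymmetrised covariant derivative of
  \<Sigma> and its commutator. The commutator completes \<open>D\<Upsilon>\<close> to \<Xi>; the
  norm of \<Upsilon> enters \<Xi> with factor 1/2 because both halves of the Kulkarni-Nomizu product
  contribute it.\<close>

lemma riemann_h:
  assumes x: "x \<in> U"
  shows "riemann h a b x = R a b x - kulkarni_nomizu (g x) (\<Xi> x) a b"
proof -
  let ?I = "matrix_inv (g x)" and ?D = "\<lambda>a b. partial_deriv a (\<Sigma> b) x + (\<Gamma> a x ** \<Sigma> b x - \<Sigma> b x ** \<Gamma> a x)"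
  let ?N = "\<Upsilon> x \<bullet> \<Upsilon>_up x"
  have d: "partial_deriv a (christoffel_matrix h b) x = partial_deriv a (\<Gamma> b) x + partial_deriv a (\<Sigma> b) x" for a b
  proof -
    have "partial_deriv a (christoffel_matrix h b) x = partial_deriv a (\<lambda>y. \<Gamma> b y + \<Sigma> b y) x"
      by (rule partial_deriv_cong[OF open_U x christoffel_h])
    then show ?thesis
      by (simp add: partial_deriv_add differentiable_christoffel deriv_\<Sigma>(1) x)
  qed
  have r: "riemann h a b x = R a b x + (?D a b - ?D b a + (\<Sigma> a x ** \<Sigma> b x - \<Sigma> b x ** \<Sigma> a x))"
    by (simp add: h.riemann_eq[OF x] riemann_eq[OF x] d christoffel_h[OF x] matrix_add_ldistrib matrix_add_rdistrib)
  have "column a (\<Gamma> b x) = column b (\<Gamma> a x)"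
    by (simp add: column_def vec_eq_iff torsion_free[OF x, of a _ b])
  then have D: "?D a b - ?D b a = outer (axis b 1) (D\<Upsilon> a x) - outer (axis a 1) (D\<Upsilon> b x)
      - outer (?I *v D\<Upsilon> a x) (g x $ b) + outer (?I *v D\<Upsilon> b x) (g x $ a)"
    unfolding covariant_deriv_\<Sigma>[OF x] by (simp add: deriv_\<Upsilon>_sym[OF x, of a b])
  have I: "?I *v \<Xi> x $ a = ?I *v D\<Upsilon> a x - \<Upsilon> x $ a *\<^sub>R \<Upsilon>_up x + (?N / 2) *\<^sub>R axis a 1" for a
    by (simp add: \<Xi>_def algebra_simps matrix_vector_mult_scaleR inv_g_row[OF x] \<Upsilon>_up_def)
  have X: "\<Xi> x $ a = D\<Upsilon> a x - \<Upsilon> x $ a *\<^sub>R \<Upsilon> x + (?N / 2) *\<^sub>R g x $ a" for a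
    by (simp add: \<Xi>_def)
  show ?thesis
    unfolding r D commutator_\<Sigma>[OF x] kulkarni_nomizu_def I unfolding X
    by (simp add: vec_eq_iff field_simps)
qed

text \<open>The Ricci tensor loses (n - 2) \<Xi> + \<tau> g. The scalar curvature term of the
  Schouten tensor removes the multiple of g, and what remains is divided by n - 2, which is nonzero
  in dimension at least 3.\<close>

lemma schouten_h:
  assumes n: "CARD('n) \<ge> 3" and x: "x \<in> U"
  shows "schouten_matrix h x = schouten_matrix g x - \<Xi> x"
proof -
  let ?I = "matrix_inv (g x)" and ?f = "exp (2 * w x)" and ?n = "real CARD('n)"
  define \<tau> where "\<tau> = trace (?I ** \<Xi> x)"
  have ric: "ricci h a b x = ricci g a b x - ((?n - 2) * \<Xi> x $ a $ b + \<tau> * g x $ a $ b)" for a b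
    using kulkarni_nomizu_ricci[OF sym[OF x] inv[OF x] \<Xi>_sym[OF x], of a b]
    by (simp add: ricci_def riemann_h[OF x] sum_subtractf \<tau>_def)
  have tr: "(\<Sum>a\<in>UNIV. \<Sum>b\<in>UNIV. ?I $ a $ b * A $ a $ b) = trace (?I ** A)" if "transpose A = A" for A
    by (simp add: trace_def matrix_matrix_mult_def symmetric_matrix_nth[OF that])
  have I: "matrix_inv (h x) = (1 / ?f) *\<^sub>R ?I"
    by (simp add: h_eq[OF x] matrix_inv_scaleR inv[OF x])
  have "scalar_curvature h x = (1 / ?f) * (\<Sum>a\<in>UNIV. \<Sum>b\<in>UNIV. ?I $ a $ b * ricci h a b x)"
    by (simp add: scalar_curvature_def I sum_distrib_left)
  also have "(\<Sum>a\<in>UNIV. \<Sum>b\<in>UNIV. ?I $ a $ b * ricci h a b x) = scalar_curvature g x -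
      ((?n - 2) * (\<Sum>a\<in>UNIV. \<Sum>b\<in>UNIV. ?I $ a $ b * \<Xi> x $ a $ b) + \<tau> * (\<Sum>a\<in>UNIV. \<Sum>b\<in>UNIV. ?I $ a $ b * g x $ a $ b))"
    by (simp add: ric scalar_curvature_def right_diff_distrib distrib_left sum_subtractf sum.distrib
        sum_distrib_left mult_ac)
  \<comment> \<open>The metric has trace n with respect to itself, so the two contributions add up
    to (n - 2) + n copies of \<tau>.\<close>
  also have "\<dots> = scalar_curvature g x - 2 * (?n - 1) * \<tau>"
    unfolding tr[OF \<Xi>_sym[OF x]] tr[OF sym[OF x]] by (simp add: \<tau>_def matrix_inv_mult inv x trace_I algebra_simps)
  finally have scal: "scalar_curvature h x = (scalar_curvature g x - 2 * (?n - 1) * \<tau>) / ?f"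
    by simp
  have "schouten h a b x = schouten g a b x - \<Xi> x $ a $ b" for a b
  proof -
    have "scalar_curvature h x / (2 * (?n - 1)) * h x $ a $ b =
        scalar_curvature g x / (2 * (?n - 1)) * g x $ a $ b - \<tau> * g x $ a $ b"
      using n by (simp add: scal h_eq[OF x] field_simps)
    then have "schouten h a b x = ((ricci g a b x - scalar_curvature g x / (2 * (?n - 1)) * g x $ a $ b)
        - (?n - 2) * \<Xi> x $ a $ b) / (?n - 2)"
      unfolding schouten_def ric by (simp add: algebra_simps)
    then show ?thesis
      using n by (simp add: schouten_def diff_divide_distrib)
  qed
  then show ?thesis
    by (simp add: schouten_matrix_def vec_eq_iff)
qed

text \<open>The Kulkarni-Nomizu term lost by the Riemann tensor is the one lost through the Schouten
  tensor, and the product with the metric is insensitive to rescaling because one index is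
  raised.\<close>

lemma weyl_h:
  assumes "CARD('n) \<ge> 3" and x: "x \<in> U"
  shows "weyl h a b x = weyl g a b x"
  by (simp add: weyl_eq riemann_h[OF x] schouten_h[OF assms] h_eq[OF x] kulkarni_nomizu_scaleR inv[OF x]
      kulkarni_nomizu_diff)

end

section \<open>Comparison of the characteristic forms at a point of a patch\<close>

context metric_patch
begin

lemma pontrjagin_character_weyl_riemann:
  assumes x: "x \<in> U" and k: "k \<ge> 1"
  shows "pontrjagin_character k (\<lambda>a b. weyl g a b x) = pontrjagin_character k (\<lambda>a b. riemann g a b x)"
proof
  fix v
  show "pontrjagin_character k (\<lambda>a b. weyl g a b x) v = pontrjagin_character k (\<lambda>a b. riemann g a b x) v"
    unfolding pontrjagin_character_eq weyl_eq
    using alt_trace_weyl[OF sym[OF x] inv[OF x] transpose_schouten[OF x] riemann_curvature_like[OF x], of "2 * k"] k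
    by simp
qed

text \<open>Skewness of the Weyl tensor turns the middle block into a conjugate of it by
  \<open>g x\<close>. The conjugating matrix is the same for all index pairs, so it passes through
  the evaluated 2-form and cancels in the alternated trace.\<close>

lemma conformal_pontrjagin_weyl:
  assumes x: "x \<in> U" and k: "k \<ge> 1"
  shows "conformal_pontrjagin k g x = pontrjagin_character k (\<lambda>a b. weyl g a b x)"
proof
  fix v
  let ?F = "\<lambda>a b. tractor_curvature g a b x" and ?C = "\<lambda>a b. weyl g a b x"
  have "middle_block (?F a b) = g x ** ?C a b ** matrix_inv (g x)" for a b
  proof -
    have "g x ** ?C a b ** matrix_inv (g x) = - (transpose (?C a b) ** g x) ** matrix_inv (g x)"
      using weyl_curvature_like[OF x] by (simp add: curvature_like_def)
    also have "\<dots> = - transpose (?C a b)"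
      by (simp add: matrix_diff_mult matrix_mul_assoc[symmetric] matrix_inv_mult inv x)
    finally show ?thesis
      by (simp add: tractor_curvature_middle[OF x])
  qed
  moreover have "middle_block (two_form ?F u w) = two_form (\<lambda>a b. middle_block (?F a b)) u w" for u w
    by (simp add: middle_block_def vec_eq_iff two_form_nth)
  ultimately have m: "middle_block (two_form ?F u w) = g x ** two_form ?C u w ** matrix_inv (g x)" for u w
    by (simp add: two_form_conjugate)
  have "strict_outer_blocks (two_form ?F u w)" for u w
    using tractor_curvature_outer[OF x] by (simp add: strict_outer_blocks_def two_form_nth)
  then have "alt_trace (replicate (2 * k) (two_form ?F)) v = alt_trace (replicate (2 * k) (two_form ?C)) v"
    using k by (simp add: alt_trace_middle_block m alt_trace_conjugate matrix_inv_mult inv x)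
  then show "conformal_pontrjagin k g x v = pontrjagin_character k ?C v"
    by (simp add: conformal_pontrjagin_def pontrjagin_character_eq)
qed

end

theorem proposition2p4:
  fixes M :: "'m topology"
    and A :: "('m, 'n::finite) chart set"
    and g :: "('m, 'n) metric"
    and k :: nat
  assumes "CARD('n) \<ge> 3"
    and "smooth_manifold M A"
    and "pseudo_riemannian_metric A g"
    and "k \<ge> 1"
  shows "\<forall>h\<in>conformal_class A g. \<forall>c\<in>A. \<forall>x\<in>chart_image c.
      conformal_pontrjagin k (h c) x = pontrjagin_character k (\<lambda>a b. weyl (g c) a b x) \<and>
      pontrjagin_character k (\<lambda>a b. weyl (g c) a b x)
        = pontrjagin_character k (\<lambda>a b. riemann (g c) a b x)"
proof (intro ballI)
  fix h c x
  assume h: "h \<in> conformal_class A g" and c: "c \<in> A" and x: "x \<in> chart_image c"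
  obtain \<omega> where \<omega>: "smooth_function A \<omega>"
    "\<And>x. x \<in> chart_image c \<Longrightarrow> h c x = exp (2 * \<omega> (chart_inv c x)) *\<^sub>R g c x"
    using h c by (auto simp: conformal_class_def)
  have op: "open (chart_image c)"
    using assms(2) c by (auto simp: smooth_manifold_def)
  have g: "smooth_on (chart_image c) (\<lambda>x. g c x $ a $ b)"
    "x \<in> chart_image c \<Longrightarrow> transpose (g c x) = g c x" "x \<in> chart_image c \<Longrightarrow> invertible (g c x)" for a b x
    using assms(3) c by (auto simp: pseudo_riemannian_metric_def)
  have "smooth_on (chart_image c) (\<omega> \<circ> chart_inv c)"
    using \<omega>(1) c by (simp add: smooth_function_def)
  \<comment> \<open>Matrix-valued \<open>C2_on\<close> is assembled from the smooth components, and
    \<omega> is read in the chart as the scale function.\<close>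
  then interpret conformal_patch "chart_image c" "g c" "\<omega> \<circ> chart_inv c" "h c"
    by unfold_locales (auto intro!: C2_on_vecI op smooth_on_C2 g simp: \<omega>(2))
  show "conformal_pontrjagin k (h c) x = pontrjagin_character k (\<lambda>a b. weyl (g c) a b x) \<and>
      pontrjagin_character k (\<lambda>a b. weyl (g c) a b x) = pontrjagin_character k (\<lambda>a b. riemann (g c) a b x)"
    \<comment> \<open>The tractor form is computed in the splitting given by \<open>h\<close>, which
      yields the Weyl tensor of \<open>h\<close>; \<open>weyl_h\<close> then identifies it with that
      of \<open>g\<close>.\<close>
    using h.conformal_pontrjagin_weyl[OF x assms(4)] pontrjagin_character_weyl_riemann[OF x assms(4)]
    by (simp add: weyl_h[OF assms(1) x])
qed

end
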